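(* Let $(X_0,X_1)$ be a Banach couple with continuous embedding $X_1\hookrightarrow X_0$ and let $0<T<\infty$. Assume $$u\in W^{1,\infty}(0,T;X_0)\cap L^\infty(0,T;X_1),$$ and denote also by $u$ its continuous $X_0$-valued representative. Then, for every $0<\eta<1$, $$u\in C^{0,1-\eta}\bigl([0,T];(X_0,X_1)_{\eta,\infty}\bigr),$$ and, with a constant $C_\eta$ depending only on $\eta$, $$[u]_{C^{0,1-\eta}([0,T];(X_0,X_1)_{\eta,\infty})}\le C_\eta\,\|u'\|_{L^\infty(0,T;X_0)}^{1-\eta}\,\|u\|_{L^\infty(0,T;X_1)}^{\eta}.$$ Moreover, $$\sup_{0\le t\le T}\|u(t)\|_{(X_0,X_1)_{\eta,\infty}}\le C_\eta\,\|u\|_{L^\infty(0,T;X_0)}^{1-\eta}\,\|u\|_{L^\infty(0,T;X_1)}^{\eta}.$$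
   Context: A Banach couple is a pair of Banach spaces continuously embedded in a common Hausdorff topological vector space. For $x\in X_0+X_1$ and $r>0$, $$K(r,x;X_0,X_1):=\inf\{\|x_0\|_{X_0}+r\|x_1\|_{X_1}: x=x_0+x_1,\ x_0\in X_0,\ x_1\in X_1\}.$$ For $0<\eta<1$, $(X_0,X_1)_{\eta,\infty}$ is the set of $x\in X_0+X_1$ with $\|x\|_{(X_0,X_1)_{\eta,\infty}}:=\sup_{r>0}r^{-\eta}K(r,x;X_0,X_1)<\infty$. For a Banach space $X$ and $0<\beta\le1$, $C^{0,\beta}([0,T];X)$ is the space of $u\in C([0,T];X)$ with finite seminorm $[u]_{C^{0,\beta}([0,T];X)}:=\sup_{0\le s<t\le T}\|u(t)-u(s)\|_X/|t-s|^\beta$. Here $W^{1,\infty}(0,T;X_0)$ is the space of $u\in L^\infty(0,T;X_0)$ whose $X_0$-valued distributional derivative $u'$ lies in $L^\infty(0,T;X_0)$. *)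

theory Defs
  imports "HOL-Analysis.Analysis" "HOL-Probability.Essential_Supremum"
begin

section \<open>Banach couples and real interpolation\<close>

text \<open>The library has no class of topological vector spaces.\<close>

class topological_real_vector = real_vector + topological_ab_group_add +
  assumes tendsto_scaleR_nhds:
    "((\<lambda>p. fst p *\<^sub>R snd p) \<longlongrightarrow> a *\<^sub>R x) (nhds a \<times>\<^sub>F nhds x)"

instance real_normed_vector \<subseteq> topological_real_vector
proof
  fix a :: real and x :: 'a
  show "((\<lambda>p. fst p *\<^sub>R snd p) \<longlongrightarrow> a *\<^sub>R x) (nhds a \<times>\<^sub>F nhds x)"
    by (intro tendsto_scaleR filterlim_fst filterlim_snd)
qed

text \<open>
  A Banach couple consists of two Banach spaces (types of class \<open>banach\<close>) together with injective
  continuous linear maps \<open>i0\<close>, \<open>i1\<close> into a common Hausdorff topological vector space. Banach spaces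
  are taken over the reals; complex ones are covered through their underlying real spaces.
\<close>

definition banach_couple ::
  "('a::banach \<Rightarrow> 'v::{topological_real_vector,t2_space}) \<Rightarrow> ('b::banach \<Rightarrow> 'v) \<Rightarrow> bool" where
  "banach_couple i0 i1 \<longleftrightarrow>
     linear i0 \<and> inj i0 \<and> continuous_on UNIV i0 \<and>
     linear i1 \<and> inj i1 \<and> continuous_on UNIV i1"

text \<open>Inside the ambient space, the space embedded by \<open>i1\<close> is contained in the one embedded by
  \<open>i0\<close>, and the inclusion \<open>J\<close> is continuous for the Banach space norms.\<close>

definition continuously_included :: "('b::banach \<Rightarrow> 'v) \<Rightarrow> ('a::banach \<Rightarrow> 'v) \<Rightarrow> bool" where
  "continuously_included i1 i0 \<longleftrightarrow> (\<exists>J. bounded_linear J \<and> (\<forall>y. i1 y = i0 (J y)))"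

definition couple_sum ::
  "('a::banach \<Rightarrow> 'v::real_vector) \<Rightarrow> ('b::banach \<Rightarrow> 'v) \<Rightarrow> 'v set" where
  "couple_sum i0 i1 = {i0 x0 + i1 x1 | x0 x1. True}"

definition K_functional ::
  "('a::banach \<Rightarrow> 'v::real_vector) \<Rightarrow> ('b::banach \<Rightarrow> 'v) \<Rightarrow> real \<Rightarrow> 'v \<Rightarrow> real" where
  "K_functional i0 i1 r x = Inf {norm x0 + r * norm x1 | x0 x1. x = i0 x0 + i1 x1}"

definition interp_space ::
  "('a::banach \<Rightarrow> 'v::real_vector) \<Rightarrow> ('b::banach \<Rightarrow> 'v) \<Rightarrow> real \<Rightarrow> 'v set" where
  "interp_space i0 i1 \<eta> =
     {x \<in> couple_sum i0 i1. bdd_above ((\<lambda>r. r powr (-\<eta>) * K_functional i0 i1 r x) ` {0<..})}"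

definition interp_norm ::
  "('a::banach \<Rightarrow> 'v::real_vector) \<Rightarrow> ('b::banach \<Rightarrow> 'v) \<Rightarrow> real \<Rightarrow> 'v \<Rightarrow> real" where
  "interp_norm i0 i1 \<eta> x = (SUP r\<in>{0<..}. r powr (-\<eta>) * K_functional i0 i1 r x)"


section \<open>Hoelder spaces\<close>

text \<open>The target normed space is given by a carrier \<open>S\<close> and a norm \<open>N\<close> on it, since interpolation
  spaces are subsets of the ambient space whose norm is not induced by the topology there.\<close>

definition holder_quotients ::
  "real \<Rightarrow> real \<Rightarrow> ('v::real_vector \<Rightarrow> real) \<Rightarrow> (real \<Rightarrow> 'v) \<Rightarrow> real set" where
  "holder_quotients T \<beta> N f =
     {N (f t - f s) / \<bar>t - s\<bar> powr \<beta> | s t. 0 \<le> s \<and> s < t \<and> t \<le> T}"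

definition holder_space ::
  "real \<Rightarrow> real \<Rightarrow> 'v::real_vector set \<Rightarrow> ('v \<Rightarrow> real) \<Rightarrow> (real \<Rightarrow> 'v) set" where
  "holder_space T \<beta> S N =
     {f. (\<forall>t\<in>{0..T}. f t \<in> S) \<and>
         (\<forall>t\<in>{0..T}. ((\<lambda>s. N (f s - f t)) \<longlongrightarrow> 0) (at t within {0..T})) \<and>
         bdd_above (holder_quotients T \<beta> N f)}"

definition holder_seminorm ::
  "real \<Rightarrow> real \<Rightarrow> ('v::real_vector \<Rightarrow> real) \<Rightarrow> (real \<Rightarrow> 'v) \<Rightarrow> real" where
  "holder_seminorm T \<beta> N f = Sup (holder_quotients T \<beta> N f)"


section \<open>Vector-valued Lebesgue and Sobolev spaces on an interval\<close>

text \<open>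
  The library's Bochner integral \<^const>\<open>has_bochner_integral\<close> is restricted to second countable
  (separable) target spaces. For arbitrary Banach spaces we use strong measurability and the same
  approximation by simple functions.
\<close>

definition strongly_measurable :: "'m measure \<Rightarrow> ('m \<Rightarrow> 'a::real_normed_vector) \<Rightarrow> bool" where
  "strongly_measurable M f \<longleftrightarrow>
     (\<exists>s. (\<forall>n. simple_function M (s n)) \<and> (AE x in M. (\<lambda>n. s n x) \<longlonglongrightarrow> f x))"

definition has_strong_bochner_integral ::
  "'m measure \<Rightarrow> ('m \<Rightarrow> 'a::real_normed_vector) \<Rightarrow> 'a \<Rightarrow> bool" where
  "has_strong_bochner_integral M f I \<longleftrightarrow>
     strongly_measurable M f \<and>
     (\<exists>s. (\<forall>n. Bochner_Integration.simple_bochner_integrable M (s n)) \<and>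
          (\<lambda>n. \<integral>\<^sup>+x. norm (f x - s n x) \<partial>M) \<longlonglongrightarrow> 0 \<and>
          (\<lambda>n. Bochner_Integration.simple_bochner_integral M (s n)) \<longlonglongrightarrow> I)"

text \<open>Functions stand for their classes modulo null sets on the open interval \<open>(0,T)\<close>.\<close>

abbreviation lebesgue_Ioo :: "real \<Rightarrow> real measure" where
  "lebesgue_Ioo T \<equiv> lebesgue_on {0<..<T}"

definition Linfty :: "real \<Rightarrow> (real \<Rightarrow> 'a::real_normed_vector) set" where
  "Linfty T = {f. strongly_measurable (lebesgue_Ioo T) f \<and>
                  esssup (lebesgue_Ioo T) (\<lambda>t. ereal (norm (f t))) < \<infinity>}"

definition Linfty_norm :: "real \<Rightarrow> (real \<Rightarrow> 'a::real_normed_vector) \<Rightarrow> real" where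
  "Linfty_norm T f = real_of_ereal (esssup (lebesgue_Ioo T) (\<lambda>t. ereal (norm (f t))))"

definition test_function :: "real \<Rightarrow> (real \<Rightarrow> real) \<Rightarrow> bool" where
  "test_function T \<phi> \<longleftrightarrow>
     (\<forall>n. (deriv ^^ n) \<phi> differentiable_on UNIV) \<and>
     compact (closure {t. \<phi> t \<noteq> 0}) \<and> closure {t. \<phi> t \<noteq> 0} \<subseteq> {0<..<T}"

text \<open>\<open>has_weak_derivative T u u'\<close> says that \<open>\<integral> \<phi>' u = - \<integral> \<phi> u'\<close> for all test functions \<open>\<phi>\<close>, both
  integrals existing.\<close>

definition has_weak_derivative ::
  "real \<Rightarrow> (real \<Rightarrow> 'a::real_normed_vector) \<Rightarrow> (real \<Rightarrow> 'a) \<Rightarrow> bool" where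
  "has_weak_derivative T u u' \<longleftrightarrow>
     (\<forall>\<phi>. test_function T \<phi> \<longrightarrow>
        (\<exists>I. has_strong_bochner_integral (lebesgue_Ioo T) (\<lambda>t. deriv \<phi> t *\<^sub>R u t) I \<and>
             has_strong_bochner_integral (lebesgue_Ioo T) (\<lambda>t. \<phi> t *\<^sub>R u' t) (- I)))"

text \<open>Membership in \<open>W\<^sup>1\<^sup>,\<^sup>\<infinity>(0,T;X)\<close>, with the (almost everywhere unique) weak derivative named.\<close>

definition W1_infty_with_deriv ::
  "real \<Rightarrow> (real \<Rightarrow> 'a::real_normed_vector) \<Rightarrow> (real \<Rightarrow> 'a) \<Rightarrow> bool" where
  "W1_infty_with_deriv T u u' \<longleftrightarrow> u \<in> Linfty T \<and> u' \<in> Linfty T \<and> has_weak_derivative T u u'"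

definition continuous_representative ::
  "real \<Rightarrow> (real \<Rightarrow> 'a::real_normed_vector) \<Rightarrow> (real \<Rightarrow> 'a) \<Rightarrow> bool" where
  "continuous_representative T u w \<longleftrightarrow>
     continuous_on {0..T} w \<and> (AE t in lebesgue_Ioo T. w t = u t)"

text \<open>
  The constant \<open>C\<^sub>\<eta>\<close>. HOL cannot quantify over types inside a formula, so an existential
  quantifier in a theorem about arbitrary Banach spaces could not express that the constant is
  independent of the spaces; a closed term of type \<open>real \<Rightarrow> real\<close> does. The factor 2 comes from
  \<open>\<parallel>u(t) - u(s)\<parallel> \<le> 2 \<parallel>u\<parallel>\<^sub>\<infinity>\<close> in the smaller space.
\<close>

definition interp_const :: "real \<Rightarrow> real" where
  "interp_const \<eta> = 2 powr \<eta>"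

end

theory Submission
  imports Defs
begin

text \<open>
  Testing the weak derivative against a smoothed indicator of \<open>[s,t]\<close>, whose derivative is a
  difference of two bumps concentrating at \<open>s\<close> and \<open>t\<close> from the right, gives
  \<open>\<parallel>u(t) - u(s)\<parallel> \<le> \<parallel>u'\<parallel>\<^sub>\<infinity> |t - s|\<close> at all right Lebesgue points of \<open>u\<close>; almost every point is one, so the
  continuous representative \<open>w\<close> is Lipschitz. Hence \<open>K(r, w(t) - w(s))\<close> is at most
  \<open>\<parallel>u'\<parallel>\<^sub>\<infinity> |t - s|\<close>, and, by approximating \<open>s\<close> and \<open>t\<close> by points where \<open>w\<close> agrees with \<open>v\<close>, at most
  \<open>2 r \<parallel>v\<parallel>\<^sub>\<infinity>\<close>. The minimum of the two bounds is at most their geometric mean with weights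
  \<open>1 - \<eta>\<close> and \<open>\<eta>\<close>, in which the powers of \<open>r\<close> cancel against \<open>r\<^sup>-\<^sup>\<eta>\<close>. The same argument applied to
  \<open>w(t)\<close> alone gives the bound on the norm.
\<close>

section \<open>Smooth step functions\<close>

text \<open>The derivative is an existential witness instead of \<open>deriv f\<close>, so that
  closure under sums, products and affine substitution follows by plain induction on the order.
  Differentiability of order 0 imposes nothing.\<close>

primrec times_differentiable :: "nat \<Rightarrow> (real \<Rightarrow> real) \<Rightarrow> bool" where
  "times_differentiable 0 f = True"
| "times_differentiable (Suc n) f =
     (\<exists>f'. (\<forall>x. (f has_real_derivative f' x) (at x)) \<and> times_differentiable n f')"

lemma times_differentiable_SucI:
  "(\<And>x. (f has_real_derivative f' x) (at x)) \<Longrightarrow> times_differentiable n f' \<Longrightarrow>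
    times_differentiable (Suc n) f"
  by auto

lemma times_differentiable_SucE:
  assumes "times_differentiable (Suc n) f"
  obtains f' where "\<And>x. (f has_real_derivative f' x) (at x)" "times_differentiable n f'"
  using assms by auto

lemma times_differentiable_Suc_imp: "times_differentiable (Suc n) f \<Longrightarrow> times_differentiable n f"
proof (induction n arbitrary: f)
  case (Suc n)
  obtain f' where "\<And>x. (f has_real_derivative f' x) (at x)" "times_differentiable (Suc n) f'"
    by (rule times_differentiable_SucE[OF Suc.prems]) (rule that)
  then show ?case
    using Suc.IH by (intro times_differentiable_SucI)
qed simp

lemma times_differentiable_const: "times_differentiable n (\<lambda>_. c)"
proof (induction n arbitrary: c)
  case (Suc n)
  have "((\<lambda>_. c) has_real_derivative 0) (at x)" for x by simp
  then show ?case using Suc[of 0] by (rule times_differentiable_SucI)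
qed simp

lemma times_differentiable_add:
  "times_differentiable n f \<Longrightarrow> times_differentiable n g \<Longrightarrow> times_differentiable n (\<lambda>x. f x + g x)"
proof (induction n arbitrary: f g)
  case (Suc n)
  obtain f' where f': "\<And>x. (f has_real_derivative f' x) (at x)" "times_differentiable n f'"
    by (rule times_differentiable_SucE[OF Suc.prems(1)]) (rule that)
  obtain g' where g': "\<And>x. (g has_real_derivative g' x) (at x)" "times_differentiable n g'"
    by (rule times_differentiable_SucE[OF Suc.prems(2)]) (rule that)
  have "((\<lambda>x. f x + g x) has_real_derivative f' x + g' x) (at x)" for x
    by (intro DERIV_add f' g')
  then show ?case using Suc.IH[OF f'(2) g'(2)] by (rule times_differentiable_SucI)
qed simp

lemma times_differentiable_mult:
  "times_differentiable n f \<Longrightarrow> times_differentiable n g \<Longrightarrow> times_differentiable n (\<lambda>x. f x * g x)"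
proof (induction n arbitrary: f g)
  case (Suc n)
  obtain f' where f': "\<And>x. (f has_real_derivative f' x) (at x)" "times_differentiable n f'"
    by (rule times_differentiable_SucE[OF Suc.prems(1)]) (rule that)
  obtain g' where g': "\<And>x. (g has_real_derivative g' x) (at x)" "times_differentiable n g'"
    by (rule times_differentiable_SucE[OF Suc.prems(2)]) (rule that)
  have "((\<lambda>x. f x * g x) has_real_derivative f' x * g x + g' x * f x) (at x)" for x
    by (intro DERIV_mult f' g')
  moreover have "times_differentiable n (\<lambda>x. f' x * g x + g' x * f x)"
    by (intro times_differentiable_add Suc.IH f'(2) g'(2) Suc.prems[THEN times_differentiable_Suc_imp])
  ultimately show ?case by (rule times_differentiable_SucI)
qed simp

lemma times_differentiable_affine:
  "times_differentiable n f \<Longrightarrow> times_differentiable n (\<lambda>x. f (a * x + b))"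
proof (induction n arbitrary: f)
  case (Suc n)
  obtain f' where *: "\<And>x. (f has_real_derivative f' x) (at x)" "times_differentiable n f'"
    by (rule times_differentiable_SucE[OF Suc.prems]) (rule that)
  have "((\<lambda>x. f (a * x + b)) has_real_derivative f' (a * x + b) * a) (at x)" for x
  proof (rule DERIV_chain2[OF *(1)])
    show "((\<lambda>x. a * x + b) has_real_derivative a) (at x)"
      by (auto intro!: derivative_eq_intros)
  qed
  moreover have "times_differentiable n (\<lambda>x. f' (a * x + b) * a)"
    by (intro times_differentiable_mult times_differentiable_const Suc.IH *)
  ultimately show ?case by (rule times_differentiable_SucI)
qed simp

text \<open>This is the bridge to the formulation with iterated \<open>deriv\<close> in
  \<open>test_function\<close>: derivatives are unique, so the witness is \<open>deriv f\<close>.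
  Differentiability of the n-th derivative consumes one order more than n.\<close>

lemma times_differentiable_higher_deriv:
  "times_differentiable (Suc n) f \<Longrightarrow> (deriv ^^ n) f differentiable_on UNIV"
proof (induction n arbitrary: f)
  case 0
  then show ?case
    by (auto simp: differentiable_on_def real_differentiable_def)
next
  case (Suc n)
  obtain f' where *: "\<And>x. (f has_real_derivative f' x) (at x)" "times_differentiable (Suc n) f'"
    by (rule times_differentiable_SucE[OF Suc.prems]) (rule that)
  then have "deriv f = f'"
    by (auto intro: DERIV_imp_deriv)
  then show ?case
    using Suc.IH[OF *(2)] by (simp del: funpow.simps add: funpow_Suc_right)
qed

text \<open>This family is closed under differentiation, so smoothness reduces to a single derivative.\<close>

definition exp_flat :: "real poly \<Rightarrow> real \<Rightarrow> real" where
  "exp_flat p x = (if 0 < x then poly p (1 / x) * exp (- 1 / x) else 0)"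

lemma poly_exp_minus_at_top: "((\<lambda>y. poly p y * exp (- y)) \<longlongrightarrow> (0::real)) at_top"
proof -
  have "((\<lambda>y. \<Sum>i\<le>degree p. coeff p i * (y ^ i / exp y)) \<longlongrightarrow> (\<Sum>i\<le>degree p. coeff p i * 0)) at_top"
    by (intro tendsto_sum tendsto_mult tendsto_const tendsto_power_div_exp_0)
  then show ?thesis
    by (simp add: poly_altdef sum_distrib_right exp_minus divide_inverse mult.assoc)
qed

text \<open>With y = 1/x, so dy/dx = -y^2, the chain rule turns p(y) exp(-y) into y^2 (p - p')(y)
  exp(-y), and \<open>[:0, 0, 1:]\<close> is the polynomial y^2. At the origin the difference
  quotient is computed from each side separately.\<close>

lemma exp_flat_DERIV:
  "(exp_flat p has_real_derivative exp_flat ([:0, 0, 1:] * (p - pderiv p)) x) (at x)"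
proof (cases "x = 0")
  case True
  \<comment> \<open>Dividing by h multiplies by y = 1/h, which is the same as replacing p by
    \<open>pCons 0 p\<close>; the decay of exp(-y) as y tends to infinity then gives the right-hand
    limit.\<close>
  have "((\<lambda>h. poly (pCons 0 p) (inverse h) * exp (- inverse h)) \<longlongrightarrow> 0) (at_right 0)"
    using poly_exp_minus_at_top[of "pCons 0 p"] filterlim_inverse_at_top_right
    by (rule filterlim_compose)
  then have right: "((\<lambda>h. exp_flat p h / h) \<longlongrightarrow> 0) (at_right 0)"
    by (rule Lim_transform_eventually)
       (rule eventually_mono[OF eventually_at_right_less], simp add: exp_flat_def divide_simps)
  have left: "((\<lambda>h. exp_flat p h / h) \<longlongrightarrow> 0) (at_left 0)"
    by (rule Lim_transform_eventually[OF tendsto_const])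
       (rule eventually_at_leftI[of "-1"], auto simp: exp_flat_def)
  have "((\<lambda>h. exp_flat p h / h) \<longlongrightarrow> 0) (at 0)"
    using left right by (rule filterlim_split_at)
  then show ?thesis
    using True by (simp add: DERIV_def exp_flat_def)
next
  case False
  show ?thesis
  proof (cases "0 < x")
    case pos: True
    have "((\<lambda>x. poly p (1 / x) * exp (- 1 / x)) has_real_derivative
        exp_flat ([:0, 0, 1:] * (p - pderiv p)) x) (at x)"
      using pos unfolding exp_flat_def
      by (auto intro!: derivative_eq_intros poly_DERIV[THEN DERIV_chain2] simp: field_simps power2_eq_square)
    then show ?thesis
      by (rule has_field_derivative_transform_within_open[of _ _ _ "{0<..}"])
         (use pos in \<open>auto simp: exp_flat_def\<close>)
  next
    case neg: False
    have "((\<lambda>_. 0) has_real_derivative exp_flat ([:0, 0, 1:] * (p - pderiv p)) x) (at x)"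
      using neg by (simp add: exp_flat_def)
    then show ?thesis
      by (rule has_field_derivative_transform_within_open[of _ _ _ "{..<0}"])
         (use neg False in \<open>auto simp: exp_flat_def\<close>)
  qed
qed

lemma times_differentiable_exp_flat: "times_differentiable n (exp_flat p)"
proof (induction n arbitrary: p)
  case (Suc n)
  show ?case by (rule times_differentiable_SucI[OF exp_flat_DERIV Suc.IH])
qed simp

text \<open>H is the antiderivative of a smooth bump on [0,1], normalised to total mass one. The
  bound B on the bump b matters later: rescaled to an interval of length h, the bump is at most B/h,
  so integrals against it are controlled by averages over that interval.\<close>

lemma smooth_step_exists:
  obtains H b :: "real \<Rightarrow> real" and B :: real
  where "\<And>n. times_differentiable n H"
    and "\<And>x. (H has_real_derivative b x) (at x)"
    and "\<And>x. 0 \<le> b x" and "\<And>x. b x \<le> B"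
    and "\<And>x. x \<notin> {0..1} \<Longrightarrow> b x = 0"
    and "\<And>x. 0 \<le> H x" and "\<And>x. H x \<le> 1"
    and "\<And>x. x \<le> 0 \<Longrightarrow> H x = 0" and "\<And>x. 1 \<le> x \<Longrightarrow> H x = 1"
proof -
  \<comment> \<open>On (0,1) this is exp(-1/x) exp(-1/(1-x)), and one factor vanishes outside. The
    reflected argument is written as \<open>- 1 * x + 1\<close> to match
    \<open>times_differentiable_affine\<close>.\<close>
  define c where "c x = exp_flat 1 x * exp_flat 1 (- 1 * x + 1)" for x
  have c_times: "times_differentiable n c" for n
    unfolding c_def by (intro times_differentiable_mult times_differentiable_affine times_differentiable_exp_flat)
  have exp_flat_1: "0 \<le> exp_flat 1 x" "exp_flat 1 x \<le> 1" for x
    by (auto simp: exp_flat_def)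
  have c_bounds: "0 \<le> c x" "c x \<le> 1" for x
    using exp_flat_1[of x] exp_flat_1[of "- 1 * x + 1"] unfolding c_def by (auto intro: mult_le_one)
  have c_zero: "c x = 0" if "x \<notin> {0<..<1}" for x
    using that by (auto simp: c_def exp_flat_def)
  have c_pos: "0 < c x" if "0 < x" "x < 1" for x
    using that by (auto simp: c_def exp_flat_def)
  have "isCont c x" for x
    using c_times[of 1] by (auto intro: DERIV_isCont)
  then obtain F0 where F0: "\<And>x. (F0 has_real_derivative c x) (at x)"
    using einterval_antiderivative[of "-\<infinity>" "\<infinity>" c]
    by (auto simp: has_real_derivative_iff_has_vector_derivative)
  define d where "d = F0 1 - F0 0"
  have "0 < d"
    unfolding d_def diff_gt_0_iff_gt
  proof (rule DERIV_pos_imp_increasing_open[of 0 1 F0])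
    show "\<exists>y. (F0 has_real_derivative y) (at x) \<and> 0 < y" if "0 < x" "x < 1" for x
      using F0[of x] c_pos[OF that] by auto
    show "continuous_on {0..1} F0"
      by (intro continuous_at_imp_continuous_on ballI DERIV_isCont[OF F0])
  qed simp
  \<comment> \<open>The subtraction and division are spelled as a sum and a product with constants
    so that the closure lemmas apply directly.\<close>
  define H where "H x = 1 / d * (F0 x + (- F0 0))" for x
  have H: "(H has_real_derivative c x / d) (at x)" for x
    using DERIV_cmult[OF DERIV_add[OF F0 DERIV_const[of "- F0 0"]], of "1 / d"] unfolding H_def by simp
  have const: "F0 x = F0 y" if "x \<le> y" "\<And>z. x \<le> z \<Longrightarrow> z \<le> y \<Longrightarrow> c z = 0" for x y
  proof (cases "x = y")
    case False
    have "F0 y = F0 x"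
    proof (rule DERIV_isconst_end[of x y F0])
      show "x < y" using that False by simp
      show "continuous_on {x..y} F0"
        by (intro continuous_at_imp_continuous_on ballI DERIV_isCont[OF F0])
      show "(F0 has_real_derivative 0) (at z)" if "x < z" "z < y" for z
        using F0[of z] \<open>\<And>z. x \<le> z \<Longrightarrow> z \<le> y \<Longrightarrow> c z = 0\<close>[of z] that by simp
    qed
    then show ?thesis by simp
  qed simp
  show ?thesis
  proof (rule that[of H "\<lambda>x. c x / d" "1 / d"])
    show "times_differentiable n H" for n
    proof (cases n)
      case (Suc m)
      have "times_differentiable n F0"
        unfolding Suc using F0 c_times by (rule times_differentiable_SucI)
      then show ?thesis
        unfolding H_def by (intro times_differentiable_mult times_differentiable_add times_differentiable_const)
    qed simp
    show H_0: "H x = 0" if "x \<le> 0" for x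
    proof -
      have "F0 x = F0 0" using that by (rule const) (simp add: c_zero)
      then show ?thesis by (simp add: H_def)
    qed
    show H_1: "H x = 1" if "1 \<le> x" for x
    proof -
      have "F0 1 = F0 x" using that by (rule const) (simp add: c_zero)
      then show ?thesis using \<open>0 < d\<close> by (simp add: H_def d_def)
    qed
    show "c x / d \<le> 1 / d" for x
      using c_bounds[of x] \<open>0 < d\<close> by (intro divide_right_mono) auto
    show "0 \<le> c x / d" for x
      using c_bounds[of x] \<open>0 < d\<close> by simp
    show "c x / d = 0" if "x \<notin> {0..1}" for x
      using c_zero[of x] that by auto
    have mono: "H x \<le> H y" if "x \<le> y" for x y
      using that
    proof (rule DERIV_nonneg_imp_nondecreasing)
      show "\<exists>D. (H has_real_derivative D) (at z) \<and> 0 \<le> D" for z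
        using H[of z] c_bounds[of z] \<open>0 < d\<close> by (intro exI[of _ "c z / d"]) auto
    qed
    show "0 \<le> H x" for x
      using mono[of 0 x] H_0[of 0] H_0[of x] by linarith
    show "H x \<le> 1" for x
      using mono[of x 1] H_1[of 1] H_1[of x] by linarith
  qed (rule H)
qed

section \<open>Strong Bochner integrals\<close>

lemma complete_measure_lebesgue_on:
  assumes "S \<in> sets lebesgue"
  shows "complete_measure (lebesgue_on S)"
proof
  fix A B assume "A \<subseteq> B" "B \<in> null_sets (lebesgue_on S)"
  then have "A \<in> null_sets lebesgue" "A \<subseteq> S"
    using assms null_sets_restrict_space[of S lebesgue]
    by (auto intro: null_sets_completion_subset)
  then show "A \<in> sets (lebesgue_on S)"
    using assms by (auto simp: sets_restrict_space_iff)
qed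

lemma (in complete_measure) borel_measurable_AE_cong:
  fixes f g :: "'a \<Rightarrow> 'c::topological_space"
  assumes f: "f \<in> borel_measurable M" and eq: "AE x in M. f x = g x"
  shows "g \<in> borel_measurable M"
proof (rule measurableI)
  fix A :: "'c set" assume "A \<in> sets borel"
  then have "f -` A \<inter> space M \<in> sets M"
    using f by simp
  moreover have "AE x in M. x \<in> f -` A \<inter> space M \<longleftrightarrow> x \<in> g -` A \<inter> space M"
    using eq by eventually_elim auto
  ultimately show "g -` A \<inter> space M \<in> sets M"
    using in_sets_AE by blast
qed simp

text \<open>The simple functions converge to f only almost everywhere and in a possibly nonseparable
  space. Their distances to \<open>s\<close> are real functions, whose pointwise limit is
  measurable; completeness of the measure then absorbs the exceptional null set.\<close>

lemma (in complete_measure) borel_measurable_norm_strongly_measurable: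
  assumes "strongly_measurable M f" and "simple_function M s"
  shows "(\<lambda>x. norm (f x - s x)) \<in> borel_measurable M"
proof -
  obtain p where p: "\<And>n. simple_function M (p n)" "AE x in M. (\<lambda>n. p n x) \<longlonglongrightarrow> f x"
    using assms(1) by (auto simp: strongly_measurable_def)
  have "(\<lambda>x. norm (p n x - s x)) \<in> borel_measurable M" for n
    by (intro borel_measurable_simple_function
        simple_function_compose2[where h="\<lambda>a b. norm (a - b)", OF p(1) assms(2)])
  then have "(\<lambda>x. lim (\<lambda>n. norm (p n x - s x))) \<in> borel_measurable M"
    by (rule borel_measurable_lim_metric)
  moreover have "AE x in M. lim (\<lambda>n. norm (p n x - s x)) = norm (f x - s x)"
    using p(2) by eventually_elim (intro limI tendsto_intros)
  ultimately show ?thesis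
    by (rule borel_measurable_AE_cong)
qed

lemma strongly_measurable_diff:
  assumes "strongly_measurable M f" "strongly_measurable M g"
  shows "strongly_measurable M (\<lambda>x. f x - g x)"
proof -
  obtain p q where "\<And>n. simple_function M (p n)" "AE x in M. (\<lambda>n. p n x) \<longlonglongrightarrow> f x"
    "\<And>n. simple_function M (q n)" "AE x in M. (\<lambda>n. q n x) \<longlonglongrightarrow> g x"
    using assms by (auto simp: strongly_measurable_def)
  then show ?thesis
    unfolding strongly_measurable_def
    by (intro exI[of _ "\<lambda>n x. p n x - q n x"] conjI allI simple_function_compose2[where h="(-)"])
       (auto elim!: eventually_elim2 intro!: tendsto_diff)
qed

context complete_measure
begin

text \<open>The inequality for simple functions, combined with the triangle inequality for the
  approximation error, passes to the limit. Staying in \<open>ennreal\<close> avoids any finiteness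
  question on the right-hand side.\<close>

lemma has_strong_bochner_integral_norm_bound:
  fixes f :: "'a \<Rightarrow> 'b::real_normed_vector"
  assumes "has_strong_bochner_integral M f I"
  shows "ennreal (norm I) \<le> (\<integral>\<^sup>+x. norm (f x) \<partial>M)"
proof -
  obtain s where meas: "strongly_measurable M f"
    and s: "\<And>n. Bochner_Integration.simple_bochner_integrable M (s n)"
    and lim: "(\<lambda>n. \<integral>\<^sup>+x. norm (f x - s n x) \<partial>M) \<longlonglongrightarrow> 0"
    and I: "(\<lambda>n. Bochner_Integration.simple_bochner_integral M (s n)) \<longlonglongrightarrow> I"
    using assms by (auto simp: has_strong_bochner_integral_def)
  have simple: "simple_function M (s n)" for n
    using s[of n] by (auto elim: simple_bochner_integrable.cases)
  have [measurable]: "(\<lambda>x. norm (f x)) \<in> borel_measurable M"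
    "(\<lambda>x. norm (f x - s n x)) \<in> borel_measurable M" for n
    using borel_measurable_norm_strongly_measurable[OF meas, of "\<lambda>_. 0"]
      borel_measurable_norm_strongly_measurable[OF meas simple] by auto
  have "ennreal (norm (Bochner_Integration.simple_bochner_integral M (s n)))
      \<le> (\<integral>\<^sup>+x. norm (f x) \<partial>M) + (\<integral>\<^sup>+x. norm (f x - s n x) \<partial>M)" for n
  proof -
    have int: "Bochner_Integration.simple_bochner_integrable M (\<lambda>x. norm (s n x))"
      using simple_bochner_integrable_compose2[of "\<lambda>x _. norm x", OF _ s s] by simp
    have "ennreal (norm (Bochner_Integration.simple_bochner_integral M (s n))) \<le> Bochner_Integration.simple_bochner_integral M (\<lambda>x. norm (s n x))"
      by (intro ennreal_leI simple_bochner_integral_norm_bound s)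
    also have "\<dots> = (\<integral>\<^sup>+x. norm (s n x) \<partial>M)"
      using int by (intro simple_bochner_integral_eq_nn_integral) auto
    also have "\<dots> \<le> (\<integral>\<^sup>+x. ennreal (norm (f x)) + ennreal (norm (f x - s n x)) \<partial>M)"
      by (intro nn_integral_mono)
         (metis ennreal_leI ennreal_plus norm_ge_zero norm_minus_commute norm_triangle_sub)
    also have "\<dots> = (\<integral>\<^sup>+x. norm (f x) \<partial>M) + (\<integral>\<^sup>+x. norm (f x - s n x) \<partial>M)"
      by (rule nn_integral_add) measurable
    finally show ?thesis .
  qed
  moreover have "(\<lambda>n. ennreal (norm (Bochner_Integration.simple_bochner_integral M (s n)))) \<longlonglongrightarrow> ennreal (norm I)"
    using I by (intro tendsto_ennrealI tendsto_norm)
  moreover have "(\<lambda>n. (\<integral>\<^sup>+x. norm (f x) \<partial>M) + (\<integral>\<^sup>+x. norm (f x - s n x) \<partial>M))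
      \<longlonglongrightarrow> (\<integral>\<^sup>+x. norm (f x) \<partial>M) + 0"
    by (intro tendsto_add tendsto_const lim)
  ultimately show ?thesis
    using LIMSEQ_le by (metis (no_types, lifting) add.right_neutral)
qed

lemma has_strong_bochner_integral_diff:
  assumes "has_strong_bochner_integral M f I" "has_strong_bochner_integral M g J"
  shows "has_strong_bochner_integral M (\<lambda>x. f x - g x) (I - J)"
proof -
  obtain s where f: "strongly_measurable M f"
    and s: "\<And>n. Bochner_Integration.simple_bochner_integrable M (s n)"
    "(\<lambda>n. \<integral>\<^sup>+x. norm (f x - s n x) \<partial>M) \<longlonglongrightarrow> 0"
    "(\<lambda>n. Bochner_Integration.simple_bochner_integral M (s n)) \<longlonglongrightarrow> I"
    using assms(1) by (auto simp: has_strong_bochner_integral_def)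
  obtain t where g: "strongly_measurable M g"
    and t: "\<And>n. Bochner_Integration.simple_bochner_integrable M (t n)"
    "(\<lambda>n. \<integral>\<^sup>+x. norm (g x - t n x) \<partial>M) \<longlonglongrightarrow> 0"
    "(\<lambda>n. Bochner_Integration.simple_bochner_integral M (t n)) \<longlonglongrightarrow> J"
    using assms(2) by (auto simp: has_strong_bochner_integral_def)
  have simple: "simple_function M (s n)" "simple_function M (t n)" for n
    using s(1)[of n] t(1)[of n] by (auto elim: simple_bochner_integrable.cases)
  note [measurable] = borel_measurable_norm_strongly_measurable[OF f simple(1)]
    borel_measurable_norm_strongly_measurable[OF g simple(2)]
  have "(\<lambda>n. \<integral>\<^sup>+x. norm ((f x - g x) - (s n x - t n x)) \<partial>M) \<longlonglongrightarrow> 0"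
  proof (rule tendsto_sandwich[OF _ _ tendsto_const])
    have "(\<integral>\<^sup>+x. norm ((f x - g x) - (s n x - t n x)) \<partial>M)
        \<le> (\<integral>\<^sup>+x. norm (f x - s n x) \<partial>M) + (\<integral>\<^sup>+x. norm (g x - t n x) \<partial>M)" for n
    proof -
      have "(\<integral>\<^sup>+x. norm ((f x - g x) - (s n x - t n x)) \<partial>M)
          \<le> (\<integral>\<^sup>+x. ennreal (norm (f x - s n x)) + ennreal (norm (g x - t n x)) \<partial>M)"
      proof (intro nn_integral_mono)
        fix x
        have "norm ((f x - g x) - (s n x - t n x)) \<le> norm (f x - s n x) + norm (g x - t n x)"
          using norm_triangle_ineq4[of "f x - s n x" "g x - t n x"] by (simp add: algebra_simps)
        then show "ennreal (norm ((f x - g x) - (s n x - t n x)))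
            \<le> ennreal (norm (f x - s n x)) + ennreal (norm (g x - t n x))"
          by (simp flip: ennreal_plus)
      qed
      also have "\<dots> = (\<integral>\<^sup>+x. norm (f x - s n x) \<partial>M) + (\<integral>\<^sup>+x. norm (g x - t n x) \<partial>M)"
        by (rule nn_integral_add) measurable
      finally show ?thesis .
    qed
    then show "\<forall>\<^sub>F n in sequentially. (\<integral>\<^sup>+x. norm ((f x - g x) - (s n x - t n x)) \<partial>M)
        \<le> (\<integral>\<^sup>+x. norm (f x - s n x) \<partial>M) + (\<integral>\<^sup>+x. norm (g x - t n x) \<partial>M)"
      by simp
    show "(\<lambda>n. (\<integral>\<^sup>+x. norm (f x - s n x) \<partial>M) + (\<integral>\<^sup>+x. norm (g x - t n x) \<partial>M)) \<longlonglongrightarrow> 0"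
      using tendsto_add[OF s(2) t(2)] by simp
  qed simp
  moreover have "Bochner_Integration.simple_bochner_integrable M (\<lambda>x. s n x - t n x)" for n
    using simple_bochner_integrable_compose2[of "(-)", OF _ s(1) t(1)] by simp
  moreover have "(\<lambda>n. Bochner_Integration.simple_bochner_integral M (\<lambda>x. s n x - t n x)) \<longlonglongrightarrow> I - J"
    using tendsto_diff[OF s(3) t(3)] s(1) t(1) by (simp add: simple_bochner_integral_diff)
  ultimately show ?thesis
    unfolding has_strong_bochner_integral_def using strongly_measurable_diff[OF f g]
    by (auto intro!: exI[of _ "\<lambda>n x. s n x - t n x"])
qed

end

text \<open>Scalar simple approximations of g, multiplied by c, approximate the product. Applied to
  a bump of mass one, this represents a fixed vector such as u(s) as an integral, to be compared
  with the integral of the bump times u.\<close>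

lemma has_strong_bochner_integral_scaleR_const:
  fixes g :: "'m \<Rightarrow> real" and c :: "'a::real_normed_vector"
  assumes "integrable M g"
  shows "has_strong_bochner_integral M (\<lambda>x. g x *\<^sub>R c) (integral\<^sup>L M g *\<^sub>R c)"
proof -
  have meas: "g \<in> borel_measurable M"
    using assms by simp
  obtain s where s: "\<And>n. Bochner_Integration.simple_bochner_integrable M (s n)"
    "(\<lambda>n. \<integral>\<^sup>+x. norm (g x - s n x) \<partial>M) \<longlonglongrightarrow> 0"
    "(\<lambda>n. Bochner_Integration.simple_bochner_integral M (s n)) \<longlonglongrightarrow> integral\<^sup>L M g"
    using has_bochner_integral_integrable[OF assms] by cases (rule that)
  obtain p where p: "\<And>n. simple_function M (p n)" "\<And>x. x \<in> space M \<Longrightarrow> (\<lambda>n. p n x) \<longlonglongrightarrow> g x"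
    using borel_measurable_implies_sequence_metric[OF meas, of 0] by auto
  have "strongly_measurable M (\<lambda>x. g x *\<^sub>R c)"
    unfolding strongly_measurable_def
    using p by (intro exI[of _ "\<lambda>n x. p n x *\<^sub>R c"])
      (auto intro!: simple_function_compose1[where g="\<lambda>y. y *\<^sub>R c"] AE_I2 tendsto_scaleR)
  moreover have "Bochner_Integration.simple_bochner_integrable M (\<lambda>x. s n x *\<^sub>R c)" for n
    using simple_bochner_integrable_compose2[of "\<lambda>y _. y *\<^sub>R c", OF _ s(1) s(1)] by simp
  moreover have "(\<lambda>n. Bochner_Integration.simple_bochner_integral M (\<lambda>x. s n x *\<^sub>R c)) \<longlonglongrightarrow> integral\<^sup>L M g *\<^sub>R c"
  proof -
    have "Bochner_Integration.simple_bochner_integral M (\<lambda>x. s n x *\<^sub>R c)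
        = Bochner_Integration.simple_bochner_integral M (s n) *\<^sub>R c" for n
      by (rule simple_bochner_integral_linear[OF bounded_linear.linear[OF bounded_linear_scaleR_left] s(1)])
    then show ?thesis
      using tendsto_scaleR[OF s(3) tendsto_const, of c] by simp
  qed
  moreover have "(\<lambda>n. \<integral>\<^sup>+x. norm (g x *\<^sub>R c - s n x *\<^sub>R c) \<partial>M) \<longlonglongrightarrow> 0"
  proof -
    have "(\<integral>\<^sup>+x. norm (g x *\<^sub>R c - s n x *\<^sub>R c) \<partial>M) = norm c * (\<integral>\<^sup>+x. norm (g x - s n x) \<partial>M)" for n
    proof -
      have [measurable]: "s n \<in> borel_measurable M"
        using s(1)[of n] by (auto elim: simple_bochner_integrable.cases intro: borel_measurable_simple_function)
      have "norm (g x *\<^sub>R c - s n x *\<^sub>R c) = norm c * norm (g x - s n x)" for x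
        by (simp flip: scaleR_diff_left)
      then show ?thesis
        using meas by (simp add: ennreal_mult nn_integral_cmult)
    qed
    then show ?thesis
      using ennreal_tendsto_cmult[OF _ s(2), of "norm c"] by simp
  qed
  ultimately show ?thesis
    unfolding has_strong_bochner_integral_def
    by (intro conjI exI[of _ "\<lambda>n x. s n x *\<^sub>R c"] allI)
qed

section \<open>Lebesgue points of vector-valued functions\<close>

text \<open>This is Lebesgue differentiation along the intervals [x, x+h]. Only the upper estimate
  is kept, and the division by h is cleared, so that it can be used inside nonnegative
  integrals.\<close>

lemma right_lebesgue_points_bounded:
  fixes g :: "real \<Rightarrow> real"
  assumes g: "g \<in> borel_measurable lebesgue" "\<And>x. 0 \<le> g x" "\<And>x. g x \<le> B"
  shows "AE x in lebesgue. \<forall>e>0. \<exists>d>0. \<forall>h. 0 < h \<and> h < d \<longrightarrow>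
    (\<integral>\<^sup>+y\<in>{x..x+h}. ennreal (g y) \<partial>lebesgue) \<le> ennreal ((g x + e) * h)"
proof -
  have int: "g integrable_on cbox a b" for a b
  proof (rule measurable_bounded_by_integrable_imp_integrable[where g="\<lambda>_. B"])
    show "g \<in> borel_measurable (lebesgue_on (cbox a b))"
      using g(1) by (rule measurable_restrict_space1)
  qed (use g in auto)
  obtain N where N: "negligible N" "\<And>x e. x \<notin> N \<Longrightarrow> 0 < e \<Longrightarrow> \<exists>d>0. \<forall>h. 0 < h \<and> h < d \<longrightarrow>
      norm (integral (cbox x (x + h *\<^sub>R One)) g /\<^sub>R h ^ DIM(real) - g x) < e"
    using integrable_ccontinuous_explicit[OF int] by metis
  have "\<exists>d>0. \<forall>h. 0 < h \<and> h < d \<longrightarrow>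
    (\<integral>\<^sup>+y\<in>{x..x+h}. ennreal (g y) \<partial>lebesgue) \<le> ennreal ((g x + e) * h)"
    if xe: "x \<notin> N" "0 < e" for x e
  proof -
    obtain d where d: "d > 0" "\<And>h. 0 < h \<Longrightarrow> h < d \<Longrightarrow> \<bar>integral {x..x + h} g / h - g x\<bar> < e"
      using N(2)[OF xe] by (auto simp: divide_inverse mult.commute)
    have "(\<integral>\<^sup>+y\<in>{x..x+h}. ennreal (g y) \<partial>lebesgue) \<le> ennreal ((g x + e) * h)"
      if h: "0 < h" "h < d" for h
    proof -
      have "(g has_integral integral {x..x+h} g) {x..x+h}"
        using int[of x "x + h"] by (simp add: has_integral_integral)
      then have "(\<integral>\<^sup>+y\<in>{x..x+h}. ennreal (g y) \<partial>lebesgue) = ennreal (integral {x..x+h} g)"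
        using nn_integral_has_integral_lebesgue'[of "{x..x+h}" g] g(2) by (simp add: nn_integral_completion)
      also have "\<dots> \<le> ennreal ((g x + e) * h)"
        using d(2)[OF h] h by (intro ennreal_leI) (auto simp: abs_less_iff field_simps)
      finally show ?thesis .
    qed
    with d(1) show ?thesis by blast
  qed
  then have "\<forall>e>0. \<exists>d>0. \<forall>h. 0 < h \<and> h < d \<longrightarrow>
    (\<integral>\<^sup>+y\<in>{x..x+h}. ennreal (g y) \<partial>lebesgue) \<le> ennreal ((g x + e) * h)" if "x \<notin> N" for x
    using that by blast
  moreover have "AE x in lebesgue. x \<notin> N"
    using N(1) by (simp add: negligible_iff_null_sets AE_not_in)
  ultimately show ?thesis
    by (auto elim: eventually_mono)
qed

text \<open>The scalar differentiation theorem is applied to \<open>\<lambda>y. \<parallel>f y - c\<parallel>\<close> for each of the countably many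
  values \<open>c\<close> of a sequence of simple functions converging to \<open>f\<close>; the truncation in \<open>g\<close> makes these
  functions locally integrable without changing them almost everywhere.\<close>

lemma right_lebesgue_points:
  fixes f :: "real \<Rightarrow> 'a::real_normed_vector"
  assumes meas: "strongly_measurable (lebesgue_Ioo T) f"
    and bdd: "AE x in lebesgue_Ioo T. norm (f x) \<le> M"
  shows "AE x in lebesgue_Ioo T. \<forall>e>0. \<exists>d>0. \<forall>h. 0 < h \<and> h < d \<longrightarrow>
    (\<integral>\<^sup>+y\<in>{x..x+h}. ennreal (norm (f y - f x)) \<partial>lebesgue_Ioo T) \<le> ennreal (e * h)"
proof -
  interpret complete_measure "lebesgue_Ioo T"
    by (rule complete_measure_lebesgue_on) simp
  obtain s where s: "\<And>n. simple_function (lebesgue_Ioo T) (s n)"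
    and lim: "AE x in lebesgue_Ioo T. (\<lambda>n. s n x) \<longlonglongrightarrow> f x"
    using meas by (auto simp: strongly_measurable_def)
  define D where "D = (\<Union>n. s n ` {0<..<T})"
  have "countable D"
    unfolding D_def using simple_functionD(1)[OF s] by (intro countable_UN countableI_type countable_finite) auto
  \<comment> \<open>Extension by zero allows the use of a theorem on the whole line. The maximum
    with 0 keeps g nonnegative without a sign assumption on M.\<close>
  define g where "g c y = (if y \<in> {0<..<T} then min (norm (f y - c)) (max 0 M + norm c) else 0)" for c y
  have g_le: "g c y \<le> norm (f y - c)" for c y
    by (auto simp: g_def)
  have g_nonneg: "0 \<le> g c y" for c y
    by (auto simp: g_def)
  have g_meas: "g c \<in> borel_measurable lebesgue" for c
  proof -
    have "(\<lambda>y. norm (f y - c)) \<in> borel_measurable (lebesgue_Ioo T)"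
      by (rule borel_measurable_norm_strongly_measurable[OF meas]) simp
    then show ?thesis
      unfolding g_def by (intro borel_measurable_if_I borel_measurable_min) auto
  qed
  have "AE x in lebesgue. \<forall>c\<in>D. \<forall>e>0. \<exists>d>0. \<forall>h. 0 < h \<and> h < d \<longrightarrow>
    (\<integral>\<^sup>+y\<in>{x..x+h}. ennreal (g c y) \<partial>lebesgue) \<le> ennreal ((g c x + e) * h)"
    unfolding AE_ball_countable[OF \<open>countable D\<close>]
  proof
    fix c
    show "AE x in lebesgue. \<forall>e>0. \<exists>d>0. \<forall>h. 0 < h \<and> h < d \<longrightarrow>
      (\<integral>\<^sup>+y\<in>{x..x+h}. ennreal (g c y) \<partial>lebesgue) \<le> ennreal ((g c x + e) * h)"
      by (rule right_lebesgue_points_bounded[OF g_meas, of _ "max 0 M + norm c"]) (auto simp: g_def)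
  qed
  then have "AE x in lebesgue_Ioo T. \<forall>c\<in>D. \<forall>e>0. \<exists>d>0. \<forall>h. 0 < h \<and> h < d \<longrightarrow>
    (\<integral>\<^sup>+y\<in>{x..x+h}. ennreal (g c y) \<partial>lebesgue) \<le> ennreal ((g c x + e) * h)"
    by (auto simp: AE_restrict_space_iff elim: eventually_mono)
  moreover have "AE x in lebesgue_Ioo T. x \<in> {0<..<T}"
    by (simp add: AE_restrict_space_iff)
  ultimately show ?thesis
    using lim
  proof eventually_elim
    case (elim x)
    show ?case
    proof (intro allI impI)
      fix e :: real assume "0 < e"
      \<comment> \<open>Three errors of size e/4 arise: replacing f x by c in the integrand, the
        value g c x itself, and the tolerance in the differentiation theorem. Their sum stays below
        e.\<close>
      then obtain n where n: "norm (s n x - f x) < e / 4"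
        using LIMSEQ_D[OF elim(3), of "e / 4"] by auto
      define c where "c = s n x"
      have c: "c \<in> D" "norm (f x - c) < e / 4"
        using elim(2) n unfolding c_def D_def by (blast, simp add: norm_minus_commute)
      obtain d where "d > 0" and d: "\<And>h. 0 < h \<Longrightarrow> h < d \<Longrightarrow>
        (\<integral>\<^sup>+y\<in>{x..x+h}. ennreal (g c y) \<partial>lebesgue) \<le> ennreal ((g c x + e / 4) * h)"
        using elim(1) c(1) \<open>0 < e\<close> by (metis divide_pos_pos zero_less_numeral)
      have "(\<integral>\<^sup>+y\<in>{x..x+h}. ennreal (norm (f y - f x)) \<partial>lebesgue_Ioo T) \<le> ennreal (e * h)"
        if h: "0 < h" "h < d" for h
      proof -
        have meas_summands: "(\<lambda>y. ennreal (g c y) * indicator {x..x+h} y) \<in> borel_measurable lebesgue"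
          "(\<lambda>y. ennreal (e / 4) * indicator {x..x+h} y) \<in> borel_measurable lebesgue"
          by (intro borel_measurable_times_ennreal measurable_compose[OF g_meas measurable_ennreal]
              borel_measurable_indicator borel_measurable_const; simp)+
        have "AE y in lebesgue_Ioo T. norm (f y - f x) \<le> g c y + e / 4"
          using bdd AE_space
        proof eventually_elim
          case (elim y)
          then have "g c y = norm (f y - c)"
            using norm_triangle_ineq4[of "f y" c] by (auto simp: g_def)
          then show ?case
            using norm_triangle_ineq4[of "f y - c" "f x - c"] c(2) by simp
        qed
        then have "(\<integral>\<^sup>+y\<in>{x..x+h}. ennreal (norm (f y - f x)) \<partial>lebesgue_Ioo T)
            \<le> (\<integral>\<^sup>+y\<in>{x..x+h}. ennreal (g c y + e / 4) \<partial>lebesgue_Ioo T)"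
          by (intro nn_integral_mono_AE) (auto elim!: eventually_mono intro!: mult_right_mono ennreal_leI)
        also have "\<dots> \<le> (\<integral>\<^sup>+y\<in>{x..x+h}. ennreal (g c y + e / 4) \<partial>lebesgue)"
          by (subst nn_integral_restrict_space) (auto intro!: nn_integral_mono simp: indicator_def)
        also have "\<dots> = (\<integral>\<^sup>+y. ennreal (g c y) * indicator {x..x+h} y + ennreal (e / 4) * indicator {x..x+h} y \<partial>lebesgue)"
          using \<open>0 < e\<close> by (intro nn_integral_cong) (auto simp: g_def indicator_def simp flip: ennreal_plus)
        also have "\<dots> = (\<integral>\<^sup>+y\<in>{x..x+h}. ennreal (g c y) \<partial>lebesgue) + ennreal (e / 4) * emeasure lebesgue {x..x+h}"
          by (simp add: nn_integral_add meas_summands nn_integral_cmult_indicator)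
        also have "\<dots> \<le> ennreal ((g c x + e / 4) * h) + ennreal (e / 4) * ennreal h"
          using d[OF h] h by (intro add_mono) auto
        also have "\<dots> = ennreal ((g c x + e / 4) * h + e / 4 * h)"
          using h \<open>0 < e\<close> g_nonneg[of c x] by (simp flip: ennreal_plus ennreal_mult)
        also have "\<dots> \<le> ennreal (e * h)"
        proof (intro ennreal_leI)
          have "(g c x + e / 4 + e / 4) * h \<le> e * h"
            using g_le[of c x] c(2) h \<open>0 < e\<close> by (intro mult_right_mono) auto
          then show "(g c x + e / 4) * h + e / 4 * h \<le> e * h"
            by (simp add: distrib_right)
        qed
        finally show ?thesis .
      qed
      with \<open>d > 0\<close> show "\<exists>d>0. \<forall>h. 0 < h \<and> h < d \<longrightarrow>
        (\<integral>\<^sup>+y\<in>{x..x+h}. ennreal (norm (f y - f x)) \<partial>lebesgue_Ioo T) \<le> ennreal (e * h)"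
        by blast
    qed
  qed
qed

section \<open>Lipschitz continuity from a bounded weak derivative\<close>

text \<open>Both steps are 0 to the left of s and both are 1 to the right of t + e, so the
  difference cancels outside [s, t + e], a compact subset of (0,T).\<close>

lemma test_function_difference:
  assumes H: "\<And>n. times_differentiable n H" "\<And>x. x \<le> 0 \<Longrightarrow> H x = 0" "\<And>x. 1 \<le> x \<Longrightarrow> H x = 1"
    and "0 < e" "0 < s" "s < t" "t + e < T"
  shows "test_function T (\<lambda>x. H ((x - s) / e) - H ((x - t) / e))" (is "test_function T ?\<phi>")
    and "x \<notin> {s..t + e} \<Longrightarrow> H ((x - s) / e) - H ((x - t) / e) = 0"
proof -
  show zero: "H ((x - s) / e) - H ((x - t) / e) = 0" if "x \<notin> {s..t + e}" for x
  proof (cases "x < s")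
    case True
    then have "(x - s) / e \<le> 0" "(x - t) / e \<le> 0"
      using assms by (auto simp: divide_nonpos_pos)
    then show ?thesis using H(2) by simp
  next
    case False
    then have "1 \<le> (x - s) / e" "1 \<le> (x - t) / e"
      using assms that by (auto simp: field_simps)
    then show ?thesis using H(3) by simp
  qed
  have "times_differentiable n (\<lambda>x. H (1 / e * x + - s / e) + (- 1) * H (1 / e * x + - t / e))" for n
    by (intro times_differentiable_add times_differentiable_mult times_differentiable_const
        times_differentiable_affine H(1))
  moreover have "(\<lambda>x. H (1 / e * x + - s / e) + (- 1) * H (1 / e * x + - t / e)) = ?\<phi>"
    by (simp add: diff_divide_distrib)
  ultimately have "times_differentiable n ?\<phi>" for n
    by simp
  moreover have supp: "closure {x. ?\<phi> x \<noteq> 0} \<subseteq> {s..t + e}"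
    by (rule closure_minimal) (use zero in blast, simp)
  moreover have "compact (closure {x. ?\<phi> x \<noteq> 0})"
    using compact_Int_closed[of "{s..t + e}" "closure {x. ?\<phi> x \<noteq> 0}"] supp
    by (simp add: Int_absorb1)
  ultimately show "test_function T ?\<phi>"
    unfolding test_function_def using times_differentiable_higher_deriv assms(4-7) by fastforce
qed

text \<open>By the fundamental theorem of calculus the integral is the rise of the rescaled step
  over [0,T]; the whole transition [a, a + e] lies inside the interval, so the rise is 1.\<close>

lemma integral_rescaled_step_derivative:
  fixes H b :: "real \<Rightarrow> real"
  assumes H: "\<And>x. (H has_real_derivative b x) (at x)" "\<And>x. 0 \<le> b x"
    "\<And>x. x \<le> 0 \<Longrightarrow> H x = 0" "\<And>x. 1 \<le> x \<Longrightarrow> H x = 1"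
    and "0 < e" "0 < a" "a + e < T"
  shows "integrable (lebesgue_Ioo T) (\<lambda>x. b ((x - a) / e) / e)"
    and "integral\<^sup>L (lebesgue_Ioo T) (\<lambda>x. b ((x - a) / e) / e) = 1"
proof -
  have "((\<lambda>x. b ((x - a) / e) / e) has_integral H ((T - a) / e) - H ((0 - a) / e)) {0..T}"
  proof (rule fundamental_theorem_of_calculus)
    show "((\<lambda>x. H ((x - a) / e)) has_vector_derivative b ((x - a) / e) / e) (at x within {0..T})" for x
    proof -
      have "((\<lambda>x. (x - a) / e) has_real_derivative 1 / e) (at x)"
        using \<open>0 < e\<close> by (auto intro!: derivative_eq_intros)
      from DERIV_chain2[OF H(1) this]
      have "((\<lambda>x. H ((x - a) / e)) has_real_derivative b ((x - a) / e) / e) (at x)"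
        by simp
      then show ?thesis
        by (simp add: has_real_derivative_iff_has_vector_derivative has_vector_derivative_at_within)
    qed
  qed (use assms in simp)
  moreover have "H ((T - a) / e) = 1"
    using assms by (intro H(4)) (simp add: field_simps)
  moreover have "H ((0 - a) / e) = 0"
    using assms by (intro H(3)) (simp add: divide_nonpos_pos)
  ultimately have int: "((\<lambda>x. b ((x - a) / e) / e) has_integral 1) {0<..<T}"
    by (simp add: has_integral_Icc_iff_Ioo)
  then have abs: "(\<lambda>x. b ((x - a) / e) / e) absolutely_integrable_on {0<..<T}"
    using H(2) \<open>0 < e\<close> by (intro nonnegative_absolutely_integrable_1) (auto simp: has_integral_integrable)
  then show *: "integrable (lebesgue_Ioo T) (\<lambda>x. b ((x - a) / e) / e)"
    by (rule absolutely_integrable_imp_integrable) simp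
  show "integral\<^sup>L (lebesgue_Ioo T) (\<lambda>x. b ((x - a) / e) / e) = 1"
    using lebesgue_integral_eq_integral[OF *] integral_unique[OF int] by (rule trans) simp
qed

text \<open>G is the set of right Lebesgue points of u. The estimate concerns u itself on a set of
  full measure, from which a continuous representative can be built afterwards.\<close>

lemma weak_derivative_lipschitz:
  fixes u u' :: "real \<Rightarrow> 'a::real_normed_vector"
  assumes weak: "has_weak_derivative T u u'"
    and meas: "strongly_measurable (lebesgue_Ioo T) u"
    and u_bdd: "AE x in lebesgue_Ioo T. norm (u x) \<le> M"
    and u'_bdd: "AE x in lebesgue_Ioo T. norm (u' x) \<le> L" and "0 \<le> L"
  obtains G where "G \<subseteq> {0<..<T}" "AE x in lebesgue_Ioo T. x \<in> G"
    "\<And>s t. s \<in> G \<Longrightarrow> t \<in> G \<Longrightarrow> norm (u t - u s) \<le> L * \<bar>t - s\<bar>"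
proof -
  interpret complete_measure "lebesgue_Ioo T"
    by (rule complete_measure_lebesgue_on) simp
  obtain H b B where H: "\<And>n. times_differentiable n H"
      "\<And>x. (H has_real_derivative b x) (at x)"
      "\<And>x. 0 \<le> b x" "\<And>x. b x \<le> B" "\<And>x. x \<notin> {0..1} \<Longrightarrow> b x = 0"
      "\<And>x. 0 \<le> H x" "\<And>x. H x \<le> 1" "\<And>x. x \<le> 0 \<Longrightarrow> H x = 0" "\<And>x. 1 \<le> x \<Longrightarrow> H x = 1"
    by (rule smooth_step_exists) (rule that)
  have "0 \<le> B"
    using H(3,4)[of 0] by linarith
  define osc where "osc a h = (\<integral>\<^sup>+y\<in>{a..a+h}. ennreal (norm (u y - u a)) \<partial>lebesgue_Ioo T)" for a h
  define G where "G = {x \<in> {0<..<T}. \<forall>e>0. \<exists>d>0. \<forall>h. 0 < h \<and> h < d \<longrightarrow> osc x h \<le> ennreal (e * h)}"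
  have G_D: "\<exists>d>0. \<forall>h. 0 < h \<and> h < d \<longrightarrow> osc x h \<le> ennreal (e * h)" if "x \<in> G" "0 < e" for x e
    using that by (simp add: G_def)
  have G_ae: "AE x in lebesgue_Ioo T. x \<in> G"
    using right_lebesgue_points[OF meas u_bdd] AE_space
  proof eventually_elim
    case (elim x)
    have "x \<in> {0<..<T}"
      using elim(2) by simp
    then show ?case
      unfolding G_def osc_def using elim(1) by (intro CollectI conjI)
  qed
  \<comment> \<open>The first term bounds the integral of \<phi> u', since |\<phi>| is at most 1 and
    is supported on an interval of length t + h - s. The second comes from the two bumps: each has
    height at most B/h and meets an oscillation of at most e h.\<close>
  have estimate: "norm (u t - u s) \<le> L * (t + h - s) + 2 * B * e"
    if st: "0 < s" "s < t" "0 < h" "t + h < T" "0 < e"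
      and osc: "osc s h \<le> ennreal (e * h)" "osc t h \<le> ennreal (e * h)" for s t h e
  proof -
    define p where "p a x = b ((x - a) / h) / h" for a x
    define \<phi> where "\<phi> x = H ((x - s) / h) - H ((x - t) / h)" for x
    have \<phi>: "test_function T \<phi>" "\<And>x. x \<notin> {s..t + h} \<Longrightarrow> \<phi> x = 0"
      unfolding \<phi>_def by (rule test_function_difference[OF H(1,8,9) st(3,1,2,4)]; assumption)+
    have "(\<phi> has_real_derivative p s x - p t x) (at x)" for x
    proof -
      have "((\<lambda>x. (x - a) / h) has_real_derivative 1 / h) (at x)" for a
        using st by (auto intro!: derivative_eq_intros)
      from DERIV_chain2[OF H(2) this]
      have "((\<lambda>x. H ((x - a) / h)) has_real_derivative p a x) (at x)" for a
        by (simp add: p_def)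
      then show ?thesis
        unfolding \<phi>_def by (intro DERIV_diff)
    qed
    then have "deriv \<phi> x = p s x - p t x" for x
      by (rule DERIV_imp_deriv)
    then obtain I where I: "has_strong_bochner_integral (lebesgue_Ioo T) (\<lambda>x. (p s x - p t x) *\<^sub>R u x) I"
      "has_strong_bochner_integral (lebesgue_Ioo T) (\<lambda>x. \<phi> x *\<^sub>R u' x) (- I)"
      using weak \<phi>(1) unfolding has_weak_derivative_def by auto
    have "ennreal (norm (- I)) \<le> (\<integral>\<^sup>+x. ennreal (norm (\<phi> x *\<^sub>R u' x)) \<partial>lebesgue_Ioo T)"
      by (rule has_strong_bochner_integral_norm_bound[OF I(2)])
    also have "\<dots> \<le> (\<integral>\<^sup>+x. ennreal L * indicator {s..t + h} x \<partial>lebesgue_Ioo T)"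
    proof (intro nn_integral_mono_AE)
      show "AE x in lebesgue_Ioo T. ennreal (norm (\<phi> x *\<^sub>R u' x)) \<le> ennreal L * indicator {s..t + h} x"
        using u'_bdd
      proof eventually_elim
        case (elim x)
        show ?case
        proof (cases "x \<in> {s..t + h}")
          case True
          have "\<bar>\<phi> x\<bar> \<le> 1"
            using H(6,7)[of "(x - s) / h"] H(6,7)[of "(x - t) / h"] by (auto simp: \<phi>_def)
          then have "\<bar>\<phi> x\<bar> * norm (u' x) \<le> 1 * L"
            using elim by (intro mult_mono) auto
          then show ?thesis
            using True by (auto intro: ennreal_leI)
        qed (simp add: \<phi>(2))
      qed
    qed
    also have "\<dots> \<le> (\<integral>\<^sup>+x. ennreal L * indicator {s..t + h} x \<partial>lebesgue)"
      by (subst nn_integral_restrict_space) (auto intro!: nn_integral_mono simp: indicator_def)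
    also have "\<dots> = ennreal (L * (t + h - s))"
      using st \<open>0 \<le> L\<close> by (simp add: nn_integral_cmult_indicator ennreal_mult)
    finally have I_le: "norm I \<le> L * (t + h - s)"
      using st \<open>0 \<le> L\<close> by (simp add: ennreal_le_iff)
    have p_const: "has_strong_bochner_integral (lebesgue_Ioo T) (\<lambda>x. p a x *\<^sub>R c) c"
      if "0 < a" "a + h < T" for a c
      using has_strong_bochner_integral_scaleR_const[of "lebesgue_Ioo T" "p a" c]
        integral_rescaled_step_derivative[OF H(2,3,8,9) st(3) that]
      unfolding p_def by simp
    have p_le: "p a x * r \<le> B / h * (r * indicator {a..a+h} x)" if "0 \<le> r" for a x r
    proof (cases "x \<in> {a..a+h}")
      case True
      then show ?thesis
        using H(4)[of "(x - a) / h"] st that by (auto simp: p_def divide_right_mono mult_right_mono)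
    next
      case False
      then have "(x - a) / h \<notin> {0..1}"
        using st by (auto simp: field_simps)
      then show ?thesis
        using H(5) False by (simp add: p_def)
    qed
    have Bh: "0 \<le> B / h"
      using \<open>0 \<le> B\<close> st by simp
    have meas_summand: "(\<lambda>x. ennreal (norm (u x - c)) * indicator {a..a'} x) \<in> borel_measurable (lebesgue_Ioo T)"
      for c a a'
    proof (rule borel_measurable_times_ennreal)
      have "(\<lambda>x. norm (u x - c)) \<in> borel_measurable (lebesgue_Ioo T)"
        by (rule borel_measurable_norm_strongly_measurable[OF meas]) simp
      then show "(\<lambda>x. ennreal (norm (u x - c))) \<in> borel_measurable (lebesgue_Ioo T)"
        by (rule measurable_compose[OF _ measurable_ennreal])
      show "indicator {a..a'} \<in> borel_measurable (lebesgue_Ioo T)"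
        by (intro measurable_restrict_space1 borel_measurable_indicator) simp
    qed
    \<comment> \<open>I should be close to u(s) - u(t). The vectors u(s) and -u(t) are written as
      integrals against the bumps at s and t and subtracted one after the other, whence the double
      minus.\<close>
    have "ennreal (norm (I - u s - - u t))
        \<le> (\<integral>\<^sup>+x. ennreal (norm ((p s x - p t x) *\<^sub>R u x - p s x *\<^sub>R u s - p t x *\<^sub>R - u t)) \<partial>lebesgue_Ioo T)"
      using st by (intro has_strong_bochner_integral_norm_bound has_strong_bochner_integral_diff I p_const) auto
    also have "\<dots> \<le> (\<integral>\<^sup>+x. ennreal (B / h) * (ennreal (norm (u x - u s)) * indicator {s..s+h} x)
        + ennreal (B / h) * (ennreal (norm (u x - u t)) * indicator {t..t+h} x) \<partial>lebesgue_Ioo T)"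
    proof (intro nn_integral_mono)
      fix x
      have "(p s x - p t x) *\<^sub>R u x - p s x *\<^sub>R u s - p t x *\<^sub>R - u t
          = p s x *\<^sub>R (u x - u s) - p t x *\<^sub>R (u x - u t)"
        by (simp add: algebra_simps)
      then have "norm ((p s x - p t x) *\<^sub>R u x - p s x *\<^sub>R u s - p t x *\<^sub>R - u t)
          \<le> p s x * norm (u x - u s) + p t x * norm (u x - u t)"
        using norm_triangle_ineq4[of "p s x *\<^sub>R (u x - u s)" "p t x *\<^sub>R (u x - u t)"] H(3) st
        by (simp add: p_def)
      also have "\<dots> \<le> B / h * (norm (u x - u s) * indicator {s..s+h} x)
          + B / h * (norm (u x - u t) * indicator {t..t+h} x)"
        by (intro add_mono p_le) auto
      finally have "ennreal (norm ((p s x - p t x) *\<^sub>R u x - p s x *\<^sub>R u s - p t x *\<^sub>R - u t))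
          \<le> ennreal (B / h * (norm (u x - u s) * indicator {s..s+h} x)
            + B / h * (norm (u x - u t) * indicator {t..t+h} x))"
        by (rule ennreal_leI)
      also have "\<dots> = ennreal (B / h * (norm (u x - u s) * indicator {s..s+h} x))
            + ennreal (B / h * (norm (u x - u t) * indicator {t..t+h} x))"
        using Bh by (intro ennreal_plus mult_nonneg_nonneg) auto
      also have "\<dots> = ennreal (B / h) * (ennreal (norm (u x - u s)) * indicator {s..s+h} x)
            + ennreal (B / h) * (ennreal (norm (u x - u t)) * indicator {t..t+h} x)"
        using Bh by (simp add: ennreal_mult del: times_divide_eq_left flip: ennreal_indicator)
      finally show "ennreal (norm ((p s x - p t x) *\<^sub>R u x - p s x *\<^sub>R u s - p t x *\<^sub>R - u t))
          \<le> ennreal (B / h) * (ennreal (norm (u x - u s)) * indicator {s..s+h} x)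
            + ennreal (B / h) * (ennreal (norm (u x - u t)) * indicator {t..t+h} x)" .
    qed
    also have "\<dots> = ennreal (B / h) * osc s h + ennreal (B / h) * osc t h"
      unfolding osc_def by (simp add: nn_integral_add nn_integral_cmult meas_summand borel_measurable_times_ennreal)
    also have "\<dots> \<le> ennreal (B / h) * ennreal (e * h) + ennreal (B / h) * ennreal (e * h)"
      by (intro add_mono mult_left_mono osc) auto
    also have "\<dots> = ennreal (2 * B * e)"
      using \<open>0 \<le> B\<close> st by (simp flip: ennreal_mult ennreal_plus)
    finally have "norm (I - u s - - u t) \<le> 2 * B * e"
      using \<open>0 \<le> B\<close> st by (simp add: ennreal_le_iff)
    then show ?thesis
      using I_le norm_triangle_ineq4[of "I - u s - - u t" I] by simp
  qed
  have less: "norm (u t - u s) \<le> L * (t - s)" if G_st: "s \<in> G" "t \<in> G" "s < t" for s t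
  proof (rule field_le_epsilon)
    fix r :: real assume "0 < r"
    \<comment> \<open>Since h will be below e, the excess over L (t - s) is at most (L + 2 B) e. The
      summand 1 keeps the denominator positive when L and B are only known to be
      nonnegative.\<close>
    define e where "e = r / (L + 2 * B + 1)"
    have pos: "0 < L + 2 * B + 1" using \<open>0 \<le> L\<close> \<open>0 \<le> B\<close> by simp
    then have "0 < e" using \<open>0 < r\<close> by (simp add: e_def)
    obtain d1 where d1: "0 < d1" "\<And>h. 0 < h \<Longrightarrow> h < d1 \<Longrightarrow> osc s h \<le> ennreal (e * h)"
      using G_D[OF G_st(1) \<open>0 < e\<close>] by blast
    obtain d2 where d2: "0 < d2" "\<And>h. 0 < h \<Longrightarrow> h < d2 \<Longrightarrow> osc t h \<le> ennreal (e * h)"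
      using G_D[OF G_st(2) \<open>0 < e\<close>] by blast
    have G_I: "0 < s" "t < T"
      using G_st(1,2) by (simp_all add: G_def)
    \<comment> \<open>The bounds d1 and d2 activate the Lebesgue points, e controls the term L h,
      and T - t keeps the bump at t inside the interval.\<close>
    obtain h where h: "0 < h" "h < min (min d1 d2) (min e (T - t))"
      using dense[of 0 "min (min d1 d2) (min e (T - t))"] d1(1) d2(1) \<open>0 < e\<close> G_I by auto
    have "norm (u t - u s) \<le> L * (t + h - s) + 2 * B * e"
    proof (rule estimate)
      show "osc s h \<le> ennreal (e * h)" "osc t h \<le> ennreal (e * h)"
        using h by (auto intro: d1(2) d2(2))
    qed (use h G_I G_st(3) \<open>0 < e\<close> in auto)
    also have "\<dots> \<le> L * (t - s) + (L + 2 * B + 1) * e"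
      using mult_left_mono[of h e L] h \<open>0 \<le> L\<close> \<open>0 < e\<close> by (simp add: algebra_simps)
    also have "\<dots> = L * (t - s) + r"
      using pos by (simp add: e_def)
    finally show "norm (u t - u s) \<le> L * (t - s) + r" .
  qed
  show ?thesis
  proof (rule that[of G])
    show "norm (u t - u s) \<le> L * \<bar>t - s\<bar>" if "s \<in> G" "t \<in> G" for s t
      using less[of s t] less[of t s] that by (cases s t rule: linorder_cases) (auto simp: norm_minus_commute)
  qed (use G_ae in \<open>auto simp: G_def\<close>)
qed

section \<open>Essential bounds and the density of sets of full measure\<close>

lemma Linfty_AE_norm_le:
  assumes "f \<in> Linfty T"
  shows "AE x in lebesgue_Ioo T. norm (f x) \<le> Linfty_norm T f"
proof -
  \<comment> \<open>\<open>real_of_ereal\<close> is faithful only at finite values. Membership in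
    \<open>Linfty\<close> excludes \<infinity>, and the lower bound by a norm excludes the value
    -\<infinity>.\<close>
  have "esssup (lebesgue_Ioo T) (\<lambda>t. ereal (norm (f t))) \<noteq> \<infinity>"
    using assms by (simp add: Linfty_def)
  then have "norm (f x) \<le> Linfty_norm T f"
    if "ereal (norm (f x)) \<le> esssup (lebesgue_Ioo T) (\<lambda>t. ereal (norm (f t)))" for x
    using that unfolding Linfty_norm_def
    by (cases "esssup (lebesgue_Ioo T) (\<lambda>t. ereal (norm (f t)))") auto
  then show ?thesis
    using esssup_AE[of "\<lambda>t. ereal (norm (f t))" "lebesgue_Ioo T"] by (rule eventually_mono[rotated])
qed

text \<open>A negligible set contains no nonempty open set, so the complement of G leaves no gap.
  Closed conditions valid almost everywhere thus reach every point of [0,T], endpoints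
  included.\<close>

lemma AE_lebesgue_Ioo_dense:
  assumes ae: "AE x in lebesgue_Ioo T. x \<in> G" and "0 < T"
  shows "{0..T} \<subseteq> closure ({0<..<T} \<inter> G)"
proof -
  have "AE x in lebesgue. x \<in> {0<..<T} \<longrightarrow> x \<in> G"
    using ae by (simp add: AE_restrict_space_iff)
  then have neg: "negligible ({0<..<T} - G)"
    unfolding completion.AE_iff_null_sets negligible_iff_null_sets
    by (simp add: set_diff_eq)
  have "{0<..<T} \<subseteq> closure ({0<..<T} \<inter> G)"
  proof (rule ccontr)
    assume "\<not> {0<..<T} \<subseteq> closure ({0<..<T} \<inter> G)"
    then have "{0<..<T} - closure ({0<..<T} \<inter> G) \<noteq> {}" by blast
    moreover have "open ({0<..<T} - closure ({0<..<T} \<inter> G))"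
      by (intro open_Diff) auto
    moreover have "{0<..<T} - closure ({0<..<T} \<inter> G) \<subseteq> {0<..<T} - G"
      using closure_subset[of "{0<..<T} \<inter> G"] by blast
    ultimately show False
      using neg negligible_subset open_not_negligible by blast
  qed
  then have "closure {0<..<T} \<subseteq> closure ({0<..<T} \<inter> G)"
    by (intro closure_minimal) auto
  then show ?thesis
    using \<open>0 < T\<close> by simp
qed

text \<open>The set where the essential bound holds is dense, hence nonempty, and a norm at any of
  its points lies below the bound.\<close>

lemma Linfty_norm_nonneg:
  assumes "f \<in> Linfty T" "0 < T"
  shows "0 \<le> Linfty_norm T f"
proof -
  have "{0..T} \<subseteq> closure ({0<..<T} \<inter> {x. norm (f x) \<le> Linfty_norm T f})"
    using Linfty_AE_norm_le[OF assms(1)] assms(2) by (intro AE_lebesgue_Ioo_dense) auto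
  then obtain x where "norm (f x) \<le> Linfty_norm T f"
    using assms(2) by fastforce
  then show ?thesis
    using norm_ge_zero order_trans by blast
qed

lemma continuous_on_closure_le:
  fixes w :: "'t::metric_space \<Rightarrow> 'a::real_normed_vector"
  assumes "continuous_on (closure G) w" "s \<in> closure G" "t \<in> closure G"
    and "\<And>s t. s \<in> G \<Longrightarrow> t \<in> G \<Longrightarrow> norm (w t - w s) \<le> L * dist t s" and "0 \<le> L"
  shows "norm (w t - w s) \<le> L * dist t s"
proof -
  have "L-lipschitz_on (closure G) w"
    using assms(1,4,5) by (intro lipschitz_on_closure lipschitz_onI) (auto simp: dist_norm)
  then show ?thesis
    using assms(2,3) by (auto dest: lipschitz_onD simp: dist_norm)
qed

section \<open>The interpolation estimate\<close>

lemma K_functional_le: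
  assumes "0 \<le> r"
  shows "K_functional i0 i1 r (i0 a + i1 b) \<le> norm a + r * norm b"
  unfolding K_functional_def
proof (rule cInf_lower)
  show "bdd_below {norm x0 + r * norm x1 |x0 x1. i0 a + i1 b = i0 x0 + i1 x1}"
    using assms by (intro bdd_belowI[of _ 0]) auto
qed auto

lemma K_functional_nonneg:
  assumes "0 \<le> r" "x \<in> couple_sum i0 i1"
  shows "0 \<le> K_functional i0 i1 r x"
  using assms unfolding K_functional_def couple_sum_def
  by (intro cInf_greatest) auto

lemma couple_sum_left:
  assumes "linear i1"
  shows "i0 a \<in> couple_sum i0 i1"
  using linear_0[OF assms] unfolding couple_sum_def
  by (metis (mono_tags, lifting) add.right_neutral mem_Collect_eq)

lemma K_functional_left_le:
  assumes "linear i1" "0 \<le> r"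
  shows "K_functional i0 i1 r (i0 a) \<le> norm a"
  using K_functional_le[OF assms(2), of i0 i1 a 0] linear_0[OF assms(1)] by simp

text \<open>The point \<open>i0 a\<close> itself need not lie in the range of \<open>i1\<close>: it is only a limit, in the larger
  space, of points bounded by \<open>Q\<close> in the smaller one.\<close>

lemma K_functional_closure_le:
  assumes "linear i0" "0 \<le> r"
    and approx: "\<And>e. 0 < e \<Longrightarrow> \<exists>a' b. norm (a - a') < e \<and> i0 a' = i1 b \<and> norm b \<le> Q"
  shows "K_functional i0 i1 r (i0 a) \<le> r * Q"
proof (rule field_le_epsilon)
  fix e :: real assume "0 < e"
  then obtain a' b where *: "norm (a - a') < e" "i0 a' = i1 b" "norm b \<le> Q"
    using approx by blast
  \<comment> \<open>This is the decomposition tested in the K-functional: the small remainder is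
    placed in the larger space at cost below e, and the approximant in the smaller one.\<close>
  have "i0 a = i0 (a - a') + i1 b"
    using linear_diff[OF assms(1), of a a'] * by simp
  then have "K_functional i0 i1 r (i0 a) \<le> norm (a - a') + r * norm b"
    using K_functional_le[OF assms(2), of i0 i1 "a - a'" b] by simp
  also have "\<dots> \<le> r * Q + e"
    using * mult_left_mono[OF \<open>norm b \<le> Q\<close> assms(2)] by simp
  finally show "K_functional i0 i1 r (i0 a) \<le> r * Q + e" .
qed

text \<open>Write x as the product of its powers with exponents 1 - \<eta> and \<eta>, and bound one
  factor by P and the other by Q.\<close>

lemma min_le_powr_interpolation:
  fixes x P Q :: real
  assumes "0 \<le> x" "x \<le> P" "x \<le> Q" "0 < \<eta>" "\<eta> < 1"
  shows "x \<le> P powr (1 - \<eta>) * Q powr \<eta>"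
proof (cases "x = 0")
  case False
  have "x = x powr (1 - \<eta>) * x powr \<eta>"
    using assms False by (simp flip: powr_add)
  also have "\<dots> \<le> P powr (1 - \<eta>) * Q powr \<eta>"
    using assms by (intro mult_mono powr_mono2) auto
  finally show ?thesis .
qed simp

lemma interp_norm_bound:
  assumes "linear i1" "0 < \<eta>" "\<eta> < 1" "0 \<le> Q"
    and le_P: "norm a \<le> P"
    and le_Q: "\<And>r. 0 < r \<Longrightarrow> K_functional i0 i1 r (i0 a) \<le> r * Q"
  shows "i0 a \<in> interp_space i0 i1 \<eta>"
    and "0 \<le> interp_norm i0 i1 \<eta> (i0 a)"
    and "interp_norm i0 i1 \<eta> (i0 a) \<le> P powr (1 - \<eta>) * Q powr \<eta>"
proof -
  have bound: "r powr (-\<eta>) * K_functional i0 i1 r (i0 a) \<le> P powr (1 - \<eta>) * Q powr \<eta>"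
    if "r \<in> {0<..}" for r
  proof -
    have r: "0 < r" using that by simp
    have "K_functional i0 i1 r (i0 a) \<le> P powr (1 - \<eta>) * (r * Q) powr \<eta>"
      using r assms(2,3) K_functional_nonneg[of r "i0 a" i0 i1] couple_sum_left[OF assms(1)]
        K_functional_left_le[OF assms(1), of r i0 a] le_P le_Q[OF r]
      by (intro min_le_powr_interpolation) auto
    then have "r powr (-\<eta>) * K_functional i0 i1 r (i0 a)
        \<le> r powr (-\<eta>) * (P powr (1 - \<eta>) * (r * Q) powr \<eta>)"
      by (intro mult_left_mono) auto
    also have "\<dots> = (r powr (-\<eta>) * r powr \<eta>) * (P powr (1 - \<eta>) * Q powr \<eta>)"
      using r assms(4) by (simp add: powr_mult)
    also have "\<dots> = P powr (1 - \<eta>) * Q powr \<eta>"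
      using r by (simp flip: powr_add)
    finally show ?thesis .
  qed
  have bdd: "bdd_above ((\<lambda>r. r powr (-\<eta>) * K_functional i0 i1 r (i0 a)) ` {0<..})"
    using bound by (rule bdd_aboveI2)
  then show "i0 a \<in> interp_space i0 i1 \<eta>"
    using couple_sum_left[OF assms(1)] by (auto simp: interp_space_def)
  show "interp_norm i0 i1 \<eta> (i0 a) \<le> P powr (1 - \<eta>) * Q powr \<eta>"
    unfolding interp_norm_def using bound by (intro cSUP_least) auto
  \<comment> \<open>Nonnegativity of the supremum needs only one nonnegative member of the family; r
    = 1 is taken.\<close>
  have "0 \<le> 1 powr (-\<eta>) * K_functional i0 i1 1 (i0 a)"
    using K_functional_nonneg[OF _ couple_sum_left[OF assms(1), of i0 a], of 1] by simp
  also have "\<dots> \<le> interp_norm i0 i1 \<eta> (i0 a)"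
    unfolding interp_norm_def by (rule cSUP_upper[OF _ bdd]) auto
  finally show "0 \<le> interp_norm i0 i1 \<eta> (i0 a)" .
qed

text \<open>All hypotheses are imposed on a dense set G. Bounds in the larger space extend by
  continuity of w; the bound Q in the smaller space survives only as a bound on the K-functional,
  since w(t) outside G need not come from the smaller space.\<close>

lemma interp_holder_space:
  fixes i0 :: "'a::banach \<Rightarrow> 'v::{topological_real_vector,t2_space}" and i1 :: "'b::banach \<Rightarrow> 'v"
  assumes lin: "linear i0" "linear i1" and \<eta>: "0 < \<eta>" "\<eta> < 1" and T: "0 < T"
    and G: "G \<subseteq> {0..T}" "{0..T} \<subseteq> closure G"
    and cont: "continuous_on {0..T} w"
    and lip: "\<And>s t. s \<in> G \<Longrightarrow> t \<in> G \<Longrightarrow> norm (w t - w s) \<le> L * \<bar>t - s\<bar>" and "0 \<le> L"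
    and P: "\<And>t. t \<in> G \<Longrightarrow> norm (w t) \<le> P"
    and Q: "\<And>t. t \<in> G \<Longrightarrow> i0 (w t) = i1 (v t) \<and> norm (v t) \<le> Q" and "0 \<le> Q"
  shows "(\<lambda>t. i0 (w t)) \<in> holder_space T (1 - \<eta>) (interp_space i0 i1 \<eta>) (interp_norm i0 i1 \<eta>)"
    and "holder_seminorm T (1 - \<eta>) (interp_norm i0 i1 \<eta>) (\<lambda>t. i0 (w t))
      \<le> 2 powr \<eta> * L powr (1 - \<eta>) * Q powr \<eta>"
    and "\<And>t. t \<in> {0..T} \<Longrightarrow> interp_norm i0 i1 \<eta> (i0 (w t)) \<le> P powr (1 - \<eta>) * Q powr \<eta>"
proof -
  have closure_G: "closure G = {0..T}"
    using G closure_minimal[of G "{0..T}"] by auto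
  have G_near: "\<exists>t'\<in>G. norm (w t - w t') < e" if t: "t \<in> {0..T}" and "0 < e" for t e
  proof -
    obtain d where d: "0 < d" "\<And>t'. t' \<in> {0..T} \<Longrightarrow> dist t' t \<le> d \<Longrightarrow> dist (w t') (w t) < e"
      using continuous_onE[OF cont t \<open>0 < e\<close>] by metis
    obtain t' where "t' \<in> G" "dist t' t < d"
      using closure_approachable[of t G] t \<open>0 < d\<close> closure_G by auto
    then show ?thesis
      using d(2)[of t'] G(1) by (intro bexI[of _ t']) (auto simp: dist_norm norm_minus_commute)
  qed
  have w_lip: "norm (w t - w s) \<le> L * \<bar>t - s\<bar>" if "s \<in> {0..T}" "t \<in> {0..T}" for s t
    using continuous_on_closure_le[of G w s t L] cont lip \<open>0 \<le> L\<close> that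
    by (simp add: closure_G dist_real_def)
  have w_P: "norm (w t) \<le> P" if t: "t \<in> {0..T}" for t
  proof (rule field_le_epsilon)
    fix e :: real assume "0 < e"
    then obtain t' where "t' \<in> G" "norm (w t - w t') < e"
      using G_near[OF t] by blast
    then show "norm (w t) \<le> P + e"
      using P[of t'] norm_triangle_ineq[of "w t - w t'" "w t'"] by simp
  qed
  have diff_bounds:
    "i0 (w t - w s) \<in> interp_space i0 i1 \<eta>"
    "0 \<le> interp_norm i0 i1 \<eta> (i0 (w t - w s))"
    "interp_norm i0 i1 \<eta> (i0 (w t - w s)) \<le> (L * \<bar>t - s\<bar>) powr (1 - \<eta>) * (2 * Q) powr \<eta>"
    if st: "s \<in> {0..T}" "t \<in> {0..T}" for s t
  proof -
    \<comment> \<open>Both points are approximated from G within e/2. The triangle inequality for v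
      at the two nearby points produces 2 Q, the source of the factor 2 powr \<eta>; the bound at a
      single point needs no such factor.\<close>
    have "K_functional i0 i1 r (i0 (w t - w s)) \<le> r * (2 * Q)" if "0 < r" for r
    proof (rule K_functional_closure_le[OF lin(1)])
      fix e :: real assume "0 < e"
      then obtain s' t' where *: "s' \<in> G" "norm (w s - w s') < e / 2" "t' \<in> G" "norm (w t - w t') < e / 2"
        using G_near[OF st(1), of "e / 2"] G_near[OF st(2), of "e / 2"] by auto
      have "norm (w t - w s - (w t' - w s')) < e"
        using norm_triangle_ineq4[of "w t - w t'" "w s - w s'"] * by (simp add: algebra_simps)
      moreover have "i0 (w t' - w s') = i1 (v t' - v s')"
        using Q[OF *(1)] Q[OF *(3)] lin by (simp add: linear_diff)
      moreover have "norm (v t' - v s') \<le> 2 * Q"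
        using norm_triangle_ineq4[of "v t'" "v s'"] Q[OF *(1)] Q[OF *(3)] by simp
      ultimately show "\<exists>a' b. norm (w t - w s - a') < e \<and> i0 a' = i1 b \<and> norm b \<le> 2 * Q"
        by blast
    qed (use that in simp)
    then show "i0 (w t - w s) \<in> interp_space i0 i1 \<eta>"
      "0 \<le> interp_norm i0 i1 \<eta> (i0 (w t - w s))"
      "interp_norm i0 i1 \<eta> (i0 (w t - w s)) \<le> (L * \<bar>t - s\<bar>) powr (1 - \<eta>) * (2 * Q) powr \<eta>"
      using interp_norm_bound[OF lin(2) \<eta> _ w_lip[OF st], of "2 * Q" i0] \<open>0 \<le> Q\<close> by auto
  qed
  have point_bounds: "i0 (w t) \<in> interp_space i0 i1 \<eta>"
    "interp_norm i0 i1 \<eta> (i0 (w t)) \<le> P powr (1 - \<eta>) * Q powr \<eta>"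
    if t: "t \<in> {0..T}" for t
  proof -
    have "K_functional i0 i1 r (i0 (w t)) \<le> r * Q" if "0 < r" for r
    proof (rule K_functional_closure_le[OF lin(1)])
      fix e :: real assume "0 < e"
      then show "\<exists>a' b. norm (w t - a') < e \<and> i0 a' = i1 b \<and> norm b \<le> Q"
        using G_near[OF t] Q by blast
    qed (use that in simp)
    then show "i0 (w t) \<in> interp_space i0 i1 \<eta>"
      "interp_norm i0 i1 \<eta> (i0 (w t)) \<le> P powr (1 - \<eta>) * Q powr \<eta>"
      using interp_norm_bound[OF lin(2) \<eta> \<open>0 \<le> Q\<close> w_P[OF t], of i0] by auto
  qed
  then show "\<And>t. t \<in> {0..T} \<Longrightarrow> interp_norm i0 i1 \<eta> (i0 (w t)) \<le> P powr (1 - \<eta>) * Q powr \<eta>"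
    by blast
  define C where "C = 2 powr \<eta> * L powr (1 - \<eta>) * Q powr \<eta>"
  have diff_le: "interp_norm i0 i1 \<eta> (i0 (w t) - i0 (w s)) \<le> C * \<bar>t - s\<bar> powr (1 - \<eta>)"
    if "s \<in> {0..T}" "t \<in> {0..T}" for s t
    using diff_bounds(3)[OF that] \<open>0 \<le> L\<close> \<open>0 \<le> Q\<close>
    by (simp add: linear_diff[OF lin(1)] powr_mult C_def mult_ac)
  have quotient_le: "q \<le> C"
    if "q \<in> holder_quotients T (1 - \<eta>) (interp_norm i0 i1 \<eta>) (\<lambda>t. i0 (w t))" for q
  proof -
    obtain s t where q: "q = interp_norm i0 i1 \<eta> (i0 (w t) - i0 (w s)) / \<bar>t - s\<bar> powr (1 - \<eta>)"
      and st: "0 \<le> s" "s < t" "t \<le> T"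
      using \<open>q \<in> _\<close> by (auto simp: holder_quotients_def)
    show ?thesis
      using diff_le[of s t] st unfolding q by (subst pos_divide_le_eq) auto
  qed
  have "((\<lambda>s. interp_norm i0 i1 \<eta> (i0 (w s) - i0 (w t))) \<longlongrightarrow> 0) (at t within {0..T})"
    if t: "t \<in> {0..T}" for t
  proof (rule tendsto_sandwich[OF _ _ tendsto_const])
    show "\<forall>\<^sub>F s in at t within {0..T}. 0 \<le> interp_norm i0 i1 \<eta> (i0 (w s) - i0 (w t))"
      using diff_bounds(2)[OF t] by (auto simp: eventually_at_filter linear_diff[OF lin(1)])
    show "\<forall>\<^sub>F s in at t within {0..T}.
        interp_norm i0 i1 \<eta> (i0 (w s) - i0 (w t)) \<le> C * \<bar>s - t\<bar> powr (1 - \<eta>)"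
      using diff_le[OF t] by (auto simp: eventually_at_filter)
    \<comment> \<open>The base tends to 0, so continuity of the power relies on the exponent 1 -
      \<eta> being positive.\<close>
    have "((\<lambda>s. C * \<bar>s - t\<bar> powr (1 - \<eta>)) \<longlongrightarrow> C * \<bar>t - t\<bar> powr (1 - \<eta>)) (at t within {0..T})"
      using \<eta> by (intro tendsto_mult tendsto_const tendsto_powr' tendsto_rabs tendsto_diff tendsto_ident_at) auto
    then show "((\<lambda>s. C * \<bar>s - t\<bar> powr (1 - \<eta>)) \<longlongrightarrow> 0) (at t within {0..T})"
      by simp
  qed
  then show "(\<lambda>t. i0 (w t)) \<in> holder_space T (1 - \<eta>) (interp_space i0 i1 \<eta>) (interp_norm i0 i1 \<eta>)"
    using point_bounds(1) quotient_le by (auto simp: holder_space_def intro!: bdd_aboveI)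
  \<comment> \<open>The real supremum obeys an upper bound of its members only for a nonempty set; T
    > 0 provides a pair s < t.\<close>
  have "holder_quotients T (1 - \<eta>) (interp_norm i0 i1 \<eta>) (\<lambda>t. i0 (w t)) \<noteq> {}"
    using T by (auto simp: holder_quotients_def)
  then show "holder_seminorm T (1 - \<eta>) (interp_norm i0 i1 \<eta>) (\<lambda>t. i0 (w t))
      \<le> 2 powr \<eta> * L powr (1 - \<eta>) * Q powr \<eta>"
    unfolding holder_seminorm_def using quotient_le C_def by (intro cSup_least) auto
qed

text \<open>Here \<open>v\<close> is u regarded as a function into the smaller space, the two being
  identified almost everywhere in the ambient space. The explicit \<open>bdd_above\<close> gives
  meaning to the real supremum that follows it.\<close>

theorem theorem3p8:
  fixes i0 :: "'a::banach \<Rightarrow> 'v::{topological_real_vector,t2_space}"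
    and i1 :: "'b::banach \<Rightarrow> 'v"
    and T :: real
    and u u' :: "real \<Rightarrow> 'a"
    and v :: "real \<Rightarrow> 'b"
  assumes couple: "banach_couple i0 i1"
    and embed: "continuously_included i1 i0"
    and T: "0 < T"
    and u_W: "W1_infty_with_deriv T u u'"
    and v_L: "v \<in> Linfty T"
    and u_v: "AE t in lebesgue_Ioo T. i0 (u t) = i1 (v t)"
  shows "(\<exists>w. continuous_representative T u w) \<and>
    (\<forall>w. continuous_representative T u w \<longrightarrow>
      (\<forall>\<eta>. 0 < \<eta> \<and> \<eta> < 1 \<longrightarrow>
        (\<lambda>t. i0 (w t)) \<in> holder_space T (1 - \<eta>) (interp_space i0 i1 \<eta>) (interp_norm i0 i1 \<eta>) \<and>
        holder_seminorm T (1 - \<eta>) (interp_norm i0 i1 \<eta>) (\<lambda>t. i0 (w t))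
          \<le> interp_const \<eta> * Linfty_norm T u' powr (1 - \<eta>) * Linfty_norm T v powr \<eta> \<and>
        bdd_above ((\<lambda>t. interp_norm i0 i1 \<eta> (i0 (w t))) ` {0..T}) \<and>
        (SUP t\<in>{0..T}. interp_norm i0 i1 \<eta> (i0 (w t)))
          \<le> interp_const \<eta> * Linfty_norm T u powr (1 - \<eta>) * Linfty_norm T v powr \<eta>))"
proof -
  have lin: "linear i0" "linear i1"
    using couple by (auto simp: banach_couple_def)
  have u_L: "u \<in> Linfty T" and u'_L: "u' \<in> Linfty T" and weak: "has_weak_derivative T u u'"
    using u_W by (auto simp: W1_infty_with_deriv_def)
  have "strongly_measurable (lebesgue_Ioo T) u"
    using u_L by (simp add: Linfty_def)
  then obtain G where G: "G \<subseteq> {0<..<T}" "AE x in lebesgue_Ioo T. x \<in> G"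
    "\<And>s t. s \<in> G \<Longrightarrow> t \<in> G \<Longrightarrow> norm (u t - u s) \<le> Linfty_norm T u' * \<bar>t - s\<bar>"
    using weak_derivative_lipschitz[OF weak _ Linfty_AE_norm_le[OF u_L] Linfty_AE_norm_le[OF u'_L]
        Linfty_norm_nonneg[OF u'_L T]] by blast
  \<comment> \<open>A Lipschitz map into a complete space extends to the closure of its domain, here
    containing [0,T]; the extension is the continuous representative.\<close>
  have "(Linfty_norm T u')-lipschitz_on G u"
    using G(3) Linfty_norm_nonneg[OF u'_L T]
    by (intro lipschitz_onI) (auto simp: dist_norm)
  then obtain w0 where w0: "(Linfty_norm T u')-lipschitz_on (closure G) w0" "\<And>x. x \<in> G \<Longrightarrow> w0 x = u x"
    using lipschitz_extend_closure by blast
  have "{0..T} \<subseteq> closure G"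
    using AE_lebesgue_Ioo_dense[OF G(2) T] G(1) by (simp add: Int_absorb1)
  then have "continuous_representative T u w0"
    unfolding continuous_representative_def
    using w0 G(2) lipschitz_on_continuous_on[OF w0(1)]
    by (auto intro: continuous_on_subset elim: eventually_mono)
  moreover have "(\<lambda>t. i0 (w t)) \<in> holder_space T (1 - \<eta>) (interp_space i0 i1 \<eta>) (interp_norm i0 i1 \<eta>) \<and>
        holder_seminorm T (1 - \<eta>) (interp_norm i0 i1 \<eta>) (\<lambda>t. i0 (w t))
          \<le> interp_const \<eta> * Linfty_norm T u' powr (1 - \<eta>) * Linfty_norm T v powr \<eta> \<and>
        bdd_above ((\<lambda>t. interp_norm i0 i1 \<eta> (i0 (w t))) ` {0..T}) \<and>
        (SUP t\<in>{0..T}. interp_norm i0 i1 \<eta> (i0 (w t)))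
          \<le> interp_const \<eta> * Linfty_norm T u powr (1 - \<eta>) * Linfty_norm T v powr \<eta>"
    if w: "continuous_representative T u w" and \<eta>: "0 < \<eta>" "\<eta> < 1" for w \<eta>
  proof -
    \<comment> \<open>All almost-everywhere relations are collected in one set, which is again
      dense. The continuous representative w is arbitrary here and need not be
      \<open>w0\<close>.\<close>
    define G' where "G' = {0<..<T} \<inter> {t \<in> G. w t = u t \<and> i0 (u t) = i1 (v t)
      \<and> norm (u t) \<le> Linfty_norm T u \<and> norm (v t) \<le> Linfty_norm T v}"
    have "AE t in lebesgue_Ioo T. w t = u t" and cont: "continuous_on {0..T} w"
      using w by (auto simp: continuous_representative_def)
    from this(1) G(2) u_v Linfty_AE_norm_le[OF u_L] Linfty_AE_norm_le[OF v_L]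
    have "AE t in lebesgue_Ioo T. t \<in> {t \<in> G. w t = u t \<and> i0 (u t) = i1 (v t)
      \<and> norm (u t) \<le> Linfty_norm T u \<and> norm (v t) \<le> Linfty_norm T v}"
      by eventually_elim simp
    then have dense_G': "{0..T} \<subseteq> closure G'"
      unfolding G'_def by (rule AE_lebesgue_Ioo_dense[OF _ T])
    have G'_sub: "G' \<subseteq> {0..T}"
      by (auto simp: G'_def)
    have bounds: "\<And>s t. s \<in> G' \<Longrightarrow> t \<in> G' \<Longrightarrow> norm (w t - w s) \<le> Linfty_norm T u' * \<bar>t - s\<bar>"
      "\<And>t. t \<in> G' \<Longrightarrow> norm (w t) \<le> Linfty_norm T u"
      "\<And>t. t \<in> G' \<Longrightarrow> i0 (w t) = i1 (v t) \<and> norm (v t) \<le> Linfty_norm T v"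
      using G(3) by (auto simp: G'_def)
    have holder: "(\<lambda>t. i0 (w t)) \<in> holder_space T (1 - \<eta>) (interp_space i0 i1 \<eta>) (interp_norm i0 i1 \<eta>)"
      "holder_seminorm T (1 - \<eta>) (interp_norm i0 i1 \<eta>) (\<lambda>t. i0 (w t))
        \<le> 2 powr \<eta> * Linfty_norm T u' powr (1 - \<eta>) * Linfty_norm T v powr \<eta>"
      "\<And>t. t \<in> {0..T} \<Longrightarrow> interp_norm i0 i1 \<eta> (i0 (w t))
        \<le> Linfty_norm T u powr (1 - \<eta>) * Linfty_norm T v powr \<eta>"
      by (rule interp_holder_space[OF lin \<eta> T G'_sub dense_G' cont bounds(1)
            Linfty_norm_nonneg[OF u'_L T] bounds(2,3)
            Linfty_norm_nonneg[OF v_L T]]; assumption)+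
    \<comment> \<open>The bound at single points holds with constant 1, so it also holds with the
      constant shared with the seminorm estimate.\<close>
    have const: "1 \<le> interp_const \<eta>"
      using \<eta> by (simp add: interp_const_def ge_one_powr_ge_zero)
    have sup_le: "interp_norm i0 i1 \<eta> (i0 (w t))
        \<le> interp_const \<eta> * Linfty_norm T u powr (1 - \<eta>) * Linfty_norm T v powr \<eta>"
      if "t \<in> {0..T}" for t
    proof -
      have "interp_norm i0 i1 \<eta> (i0 (w t)) \<le> 1 * (Linfty_norm T u powr (1 - \<eta>) * Linfty_norm T v powr \<eta>)"
        using holder(3)[OF that] by simp
      also have "\<dots> \<le> interp_const \<eta> * (Linfty_norm T u powr (1 - \<eta>) * Linfty_norm T v powr \<eta>)"
        by (intro mult_right_mono const) simp
      finally show ?thesis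
        by (simp add: mult.assoc)
    qed
    show ?thesis
    proof (intro conjI)
      show "bdd_above ((\<lambda>t. interp_norm i0 i1 \<eta> (i0 (w t))) ` {0..T})"
        using sup_le by (rule bdd_aboveI2)
      show "(SUP t\<in>{0..T}. interp_norm i0 i1 \<eta> (i0 (w t)))
          \<le> interp_const \<eta> * Linfty_norm T u powr (1 - \<eta>) * Linfty_norm T v powr \<eta>"
        using sup_le T by (intro cSUP_least) auto
    qed (fact holder(1), use holder(2) in \<open>unfold interp_const_def\<close>)
  qed
  ultimately show ?thesis
    by (intro conjI[of "\<exists>w. continuous_representative T u w"] exI[of _ w0] allI impI) auto
qed

end
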